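(* Let $\alpha\approx2.221\ldots$ be the root of $\alpha=1+\frac{2}{1+\exp(-1/\alpha)}$. Assume $\mathrm{e}^{-2|\beta_e|}\ge1-\frac{1}{\alpha\Delta+1}$ for all edges $e\in E$. Then there is a dynamic sampling algorithm for the Ising model on graphs with maximum degree $\Delta=O(1)$ that, upon updates of $k$ edges and vertices, returns a perfect sample (i.e. exactly distributed according to the Gibbs distribution of the updated Ising model) within $O(\log k)$ rounds and $O(k)$ incremental cost in expectation.
   Context: The Ising model on a graph $G=(V,E)$ assigns each edge $e\in E$ an inverse temperature $\beta_e\in\mathbb{R}$; its Gibbs distribution on $\sigma\in\{-1,+1\}^V$ is $\mu(\sigma)\propto\prod_{e=(u,v)\in E}\exp(\beta_e\sigma_u\sigma_v)$. $\Delta$ is the maximum degree of $G$. The dynamic sampling problem: given the current model $\mathcal{I}$, a sample $\boldsymbol{X}\sim\mu_{\mathcal{I}}$, and an update (fixed independently of $\boldsymbol{X}$) of a set of $k$ vertices and edges (adding, deleting or changing the functions of edges/vertices) transforming $\mathcal{I}$ into $\mathcal{I}'$, output a sample exactly distributed as $\mu_{\mathcal{I}'}$. The assumption on $\beta_e$ refers to the model after the update. Incremental cost is measured as the total number of individual random samplings (of variable values and of Boolean indicators) performed; a round is one parallel iteration. *)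

theory Defs
  imports "HOL-Probability.Probability"
begin

section \<open>Ising models\<close>

text \<open>Graphs are finite and simple; vertices are labelled by natural numbers so that graphs of
  every size live in one type, and constants can be uniform in the size of the graph. An edge is
  its set of two endpoints.\<close>

record ising =
  verts :: "nat set"
  edges :: "nat set set"
  beta :: "nat set \<Rightarrow> real"

definition ising_model :: "ising \<Rightarrow> bool" where
  "ising_model I \<longleftrightarrow> finite (verts I) \<and> (\<forall>e\<in>edges I. e \<subseteq> verts I \<and> card e = 2)"

definition incident :: "ising \<Rightarrow> nat \<Rightarrow> nat set set" where
  "incident I v = {e \<in> edges I. v \<in> e}"

definition max_degree :: "ising \<Rightarrow> nat" where
  "max_degree I = Max (insert 0 ((\<lambda>v. card (incident I v)) ` verts I))"

definition configs :: "ising \<Rightarrow> (nat \<Rightarrow> int) set" where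
  "configs I = verts I \<rightarrow>\<^sub>E {-1, 1}"

definition weight :: "ising \<Rightarrow> (nat \<Rightarrow> int) \<Rightarrow> real" where
  "weight I \<sigma> = (\<Prod>e\<in>edges I. exp (beta I e * real_of_int (\<Prod>v\<in>e. \<sigma> v)))"

definition partition_function :: "ising \<Rightarrow> real" where
  "partition_function I = (\<Sum>\<sigma>\<in>configs I. weight I \<sigma>)"

definition gibbs :: "ising \<Rightarrow> (nat \<Rightarrow> int) pmf" where
  "gibbs I = embed_pmf (\<lambda>\<sigma>. if \<sigma> \<in> configs I then weight I \<sigma> / partition_function I else 0)"

lemma finite_configs: "ising_model I \<Longrightarrow> finite (configs I)"
  by (simp add: ising_model_def configs_def finite_PiE)

lemma weight_pos: "weight I \<sigma> > 0"
  by (simp add: weight_def prod_pos)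

lemma partition_function_pos:
  assumes "ising_model I"
  shows "partition_function I > 0"
proof -
  have "configs I \<noteq> {}"
    by (simp add: configs_def PiE_eq_empty_iff)
  thus ?thesis
    unfolding partition_function_def
    by (intro sum_pos finite_configs assms weight_pos)
qed

lemma pmf_gibbs:
  assumes "ising_model I"
  shows "pmf (gibbs I) \<sigma> = (if \<sigma> \<in> configs I then weight I \<sigma> / partition_function I else 0)"
  unfolding gibbs_def
proof (rule pmf_embed_pmf)
  let ?f = "\<lambda>\<sigma>. if \<sigma> \<in> configs I then weight I \<sigma> / partition_function I else 0"
  note Z = partition_function_pos[OF assms]
  show nonneg: "0 \<le> ?f \<sigma>" for \<sigma>
    using Z weight_pos[of I \<sigma>] by simp
  have "(\<integral>\<^sup>+ \<sigma>. ennreal (?f \<sigma>) \<partial>count_space UNIV) = (\<Sum>\<sigma>\<in>configs I. ennreal (?f \<sigma>))"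
    by (rule nn_integral_count_space'[OF finite_configs[OF assms]]) auto
  also have "\<dots> = ennreal (\<Sum>\<sigma>\<in>configs I. ?f \<sigma>)"
    by (rule sum_ennreal) (rule nonneg)
  also have "(\<Sum>\<sigma>\<in>configs I. ?f \<sigma>) = (\<Sum>\<sigma>\<in>configs I. weight I \<sigma>) / partition_function I"
    by (simp add: sum_divide_distrib)
  also have "\<dots> = 1"
    using Z by (simp flip: partition_function_def)
  finally show "(\<integral>\<^sup>+ \<sigma>. ennreal (?f \<sigma>) \<partial>count_space UNIV) = 1"
    by simp
qed


section \<open>Updates\<close>

text \<open>An update turns \<open>I\<close> into \<open>I'\<close>. Its size counts every vertex that is added or deleted and
  every edge that is added, deleted (including the edges that disappear with a deleted vertex) or
  given a new inverse temperature. There are no vertex functions to be changed, since the model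
  has no external field.\<close>

definition updated_verts :: "ising \<Rightarrow> ising \<Rightarrow> nat set" where
  "updated_verts I I' = (verts I - verts I') \<union> (verts I' - verts I)"

definition updated_edges :: "ising \<Rightarrow> ising \<Rightarrow> nat set set" where
  "updated_edges I I' = (edges I - edges I') \<union> (edges I' - edges I) \<union>
     {e \<in> edges I \<inter> edges I'. beta I e \<noteq> beta I' e}"

definition update_size :: "ising \<Rightarrow> ising \<Rightarrow> nat" where
  "update_size I I' = card (updated_verts I I') + card (updated_edges I I')"


section \<open>Dynamic sampling algorithms\<close>

text \<open>A dynamic sampling algorithm is a parallel Las Vegas procedure that modifies the given
  sample in rounds. Every vertex stores its current spin and a private memory. One round is:

  \<^enum> in parallel, every vertex either keeps its spin or replaces it by a random value, drawn
    independently: \<open>spin_rule\<close> is \<open>None\<close> or \<open>Some\<close> of the probability of the value \<open>+1\<close>;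
  \<^enum> in parallel, every edge either does nothing or draws an independent Boolean indicator:
    \<open>flag_rule\<close> is \<open>None\<close> or \<open>Some\<close> of the probability of \<open>True\<close>;
  \<^enum> every vertex updates its memory deterministically by \<open>mem_rule\<close>.

  The algorithm stops as soon as all memories are \<open>finished\<close>.

  Only random draws are charged, so deterministic computation must not be able to see the whole
  instance: otherwise the given sample, used globally as a source of randomness, would make the
  number of draws meaningless. Therefore the rules are local. They receive partial maps carrying
  the data of the vertex's closed neighbourhood and incident edges, or of the edge and its two
  endpoints. The rules do not depend on the instance in any other way, and a spin changes only by
  being sampled.\<close>

record sampler =
  start_rule :: "nat \<Rightarrow> (nat set \<rightharpoonup> real) \<Rightarrow> (nat set \<rightharpoonup> real) \<Rightarrow> (nat \<rightharpoonup> int) \<Rightarrow> nat"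
    \<comment> \<open>vertex, inverse temperatures of its edges before and after the update, given spins\<close>
  spin_rule :: "nat \<Rightarrow> (nat set \<rightharpoonup> real) \<Rightarrow> (nat \<rightharpoonup> int) \<Rightarrow> (nat \<rightharpoonup> nat) \<Rightarrow> real option"
    \<comment> \<open>vertex, inverse temperatures, spins, memories\<close>
  flag_rule :: "nat set \<Rightarrow> real \<Rightarrow> (nat \<rightharpoonup> int) \<Rightarrow> (nat \<rightharpoonup> int) \<Rightarrow> (nat \<rightharpoonup> nat) \<Rightarrow> real option"
    \<comment> \<open>edge, inverse temperature, spins before and after the first step, memories\<close>
  mem_rule :: "nat \<Rightarrow> (nat set \<rightharpoonup> real) \<Rightarrow> (nat \<rightharpoonup> int) \<Rightarrow> (nat \<rightharpoonup> int) \<Rightarrow> (nat \<rightharpoonup> nat)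
      \<Rightarrow> (nat set \<rightharpoonup> bool) \<Rightarrow> nat"
    \<comment> \<open>vertex, inverse temperatures, spins before and after the first step, memories,
      indicators drawn at the incident edges\<close>
  finished :: "nat \<Rightarrow> bool"

definition view :: "'a set \<Rightarrow> ('a \<Rightarrow> 'b) \<Rightarrow> ('a \<rightharpoonup> 'b)" where
  "view S f = (\<lambda>x. if x \<in> S then Some (f x) else None)"

definition nbhd :: "ising \<Rightarrow> nat \<Rightarrow> nat set" where
  "nbhd I v = insert v (\<Union>(incident I v))"

type_synonym state = "(nat \<Rightarrow> int) \<times> (nat \<Rightarrow> nat)"

text \<open>Vertices added by the update start with the arbitrary spin \<open>+1\<close>.\<close>

definition initial_state :: "sampler \<Rightarrow> ising \<Rightarrow> ising \<Rightarrow> (nat \<Rightarrow> int) \<Rightarrow> state" where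
  "initial_state A I I' X =
     ((\<lambda>v\<in>verts I'. if v \<in> verts I then X v else 1),
      (\<lambda>v. start_rule A v (view (incident I v) (beta I)) (view (incident I' v) (beta I'))
             (view (verts I \<inter> (nbhd I v \<union> nbhd I' v)) X)))"

definition spin_law :: "sampler \<Rightarrow> ising \<Rightarrow> state \<Rightarrow> nat \<Rightarrow> real option" where
  "spin_law A I = (\<lambda>(X, M) v.
     spin_rule A v (view (incident I v) (beta I)) (view (nbhd I v) X) (view (nbhd I v) M))"

definition sampled_verts :: "sampler \<Rightarrow> ising \<Rightarrow> state \<Rightarrow> nat set" where
  "sampled_verts A I s = {v \<in> verts I. spin_law A I s v \<noteq> None}"

definition flag_law :: "sampler \<Rightarrow> ising \<Rightarrow> state \<Rightarrow> (nat \<Rightarrow> int) \<Rightarrow> nat set \<Rightarrow> real option" where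
  "flag_law A I = (\<lambda>(X, M) X' e. flag_rule A e (beta I e) (view e X) (view e X') (view e M))"

definition sampled_edges :: "sampler \<Rightarrow> ising \<Rightarrow> state \<Rightarrow> (nat \<Rightarrow> int) \<Rightarrow> nat set set" where
  "sampled_edges A I s X' = {e \<in> edges I. flag_law A I s X' e \<noteq> None}"

definition new_mem ::
  "sampler \<Rightarrow> ising \<Rightarrow> state \<Rightarrow> (nat \<Rightarrow> int) \<Rightarrow> (nat set \<rightharpoonup> bool) \<Rightarrow> nat \<Rightarrow> nat" where
  "new_mem A I = (\<lambda>(X, M) X' F v.
     mem_rule A v (view (incident I v) (beta I)) (view (nbhd I v) X) (view (nbhd I v) X')
       (view (nbhd I v) M) (F |` incident I v))"

definition spin_pmf :: "real \<Rightarrow> int pmf" where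
  "spin_pmf p = map_pmf (\<lambda>b. if b then 1 else -1) (bernoulli_pmf p)"

text \<open>The joint law of the state after one round and the number of random draws in that round.\<close>

definition round_pmf :: "sampler \<Rightarrow> ising \<Rightarrow> state \<Rightarrow> (state \<times> nat) pmf" where
  "round_pmf A I s =
     (let S = sampled_verts A I s in
      bind_pmf (Pi_pmf S 1 (\<lambda>v. spin_pmf (the (spin_law A I s v)))) (\<lambda>Y.
      let X' = override_on (fst s) Y S; T = sampled_edges A I s X' in
      bind_pmf (Pi_pmf T False (\<lambda>e. bernoulli_pmf (the (flag_law A I s X' e)))) (\<lambda>F.
      return_pmf ((X', new_mem A I s X' (view T F)), card S + card T))))"

definition halted :: "sampler \<Rightarrow> ising \<Rightarrow> state \<Rightarrow> bool" where
  "halted A I s \<longleftrightarrow> (\<forall>v\<in>verts I. finished A (snd s v))"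

text \<open>The joint law of the output, the number of rounds and the total number of random draws;
  the missing mass is the probability of running forever.\<close>

partial_function (spmf) run :: "sampler \<Rightarrow> ising \<Rightarrow> state \<Rightarrow> ((nat \<Rightarrow> int) \<times> nat \<times> nat) spmf"
  where
  "run A I s =
     (if halted A I s then return_spmf (fst s, 0, 0)
      else bind_spmf (spmf_of_pmf (round_pmf A I s)) (\<lambda>(s', c).
             map_spmf (\<lambda>(\<sigma>, r, n). (\<sigma>, Suc r, c + n)) (run A I s')))"

definition dynamic_sample ::
  "sampler \<Rightarrow> ising \<Rightarrow> ising \<Rightarrow> ((nat \<Rightarrow> int) \<times> nat \<times> nat) spmf" where
  "dynamic_sample A I I' =
     bind_spmf (spmf_of_pmf (gibbs I)) (\<lambda>X. run A I' (initial_state A I I' X))"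

definition output_law :: "sampler \<Rightarrow> ising \<Rightarrow> ising \<Rightarrow> (nat \<Rightarrow> int) spmf" where
  "output_law A I I' = map_spmf fst (dynamic_sample A I I')"

definition expected_rounds :: "sampler \<Rightarrow> ising \<Rightarrow> ising \<Rightarrow> ennreal" where
  "expected_rounds A I I' =
     (\<integral>\<^sup>+ (\<sigma>, r, n). of_nat r \<partial>measure_spmf (dynamic_sample A I I'))"

definition expected_cost :: "sampler \<Rightarrow> ising \<Rightarrow> ising \<Rightarrow> ennreal" where
  "expected_cost A I I' =
     (\<integral>\<^sup>+ (\<sigma>, r, n). of_nat n \<partial>measure_spmf (dynamic_sample A I I'))"

end

theory Submission
  imports Defs
begin

text \<open>The sampler keeps a set \<open>S\<close> of active vertices, initially those touched by the update. A round
  gives every active vertex a uniform spin, and every edge \<open>e\<close> meeting \<open>S\<close> passes with probability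
  \<open>\<kappa> \<phi> y\<close>, where \<open>\<phi> x = exp (\<beta> x - \<bar>\<beta>\<bar>)\<close> is the normalised weight of a spin product \<open>x\<close>, \<open>y\<close> is the
  new spin product, and \<open>\<kappa>\<close> is \<open>1\<close> if \<open>e \<subseteq> S\<close> and \<open>exp (-2 \<bar>\<beta>\<bar>) / \<phi> x\<close> for the old spin product \<open>x\<close>
  otherwise. The endpoints of the failed edges are the new active vertices.

  \<^item> The factor \<open>\<kappa>\<close> preserves the invariant that, given \<open>S\<close> and the spins on \<open>S\<close>, the other spins
    follow the conditional Gibbs law. Once \<open>S\<close> is empty, the configuration is a Gibbs sample.
  \<^item> An edge with one endpoint in \<open>S\<close> fails with probability about \<open>3 p / 2\<close> if its old spin product
    was favoured and \<open>p / 2\<close> if not, where \<open>p = 1 - exp (-2 \<bar>\<beta>\<bar>)\<close>. By the invariant, an inactive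
    spin is favoured with probability at most \<open>1 / (1 + exp (-1 / \<alpha>))\<close>, so the average failure
    probability is at most \<open>\<alpha> p / 2\<close>: this is where the equation for \<open>\<alpha>\<close> comes from. Hence the
    expected size of \<open>S\<close> shrinks by the factor \<open>\<alpha> \<Delta> / (\<alpha> \<Delta> + 1)\<close> in every round.\<close>

section \<open>The sampler\<close>

definition edge_factor :: "real \<Rightarrow> int \<Rightarrow> real" where
  "edge_factor b x = exp (b * real_of_int x - \<bar>b\<bar>)"

definition pass_prob :: "real \<Rightarrow> bool \<Rightarrow> int \<Rightarrow> int \<Rightarrow> real" where
  "pass_prob b internal x y =
     (if internal then edge_factor b y else exp (- 2 * \<bar>b\<bar>) / edge_factor b x * edge_factor b y)"

text \<open>A nonzero memory marks an active vertex, an indicator \<open>True\<close> marks a failed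
  edge, and a missing given spin \<open>X v = None\<close> marks a vertex that the update has
  added.\<close>

definition resampler :: sampler where
  "resampler =
    \<lparr>start_rule = (\<lambda>v B B' X. if X v = None \<or> B \<noteq> B' then 1 else 0),
     spin_rule = (\<lambda>v B X M. if M v = Some 0 then None else Some (1 / 2)),
     flag_rule = (\<lambda>e b X Y M.
       if \<forall>v\<in>e. M v = Some 0 then None
       else Some (1 - pass_prob b (\<forall>v\<in>e. M v \<noteq> Some 0)
                        (\<Prod>v\<in>e. the (X v)) (\<Prod>v\<in>e. the (Y v)))),
     mem_rule = (\<lambda>v B X Y M F. if Some True \<in> range F then 1 else 0),
     finished = (\<lambda>m. m = 0)\<rparr>"

definition touching :: "ising \<Rightarrow> nat set \<Rightarrow> nat set set" where
  "touching I S = {e \<in> edges I. e \<inter> S \<noteq> {}}"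

definition active :: "ising \<Rightarrow> (nat \<Rightarrow> nat) \<Rightarrow> nat set" where
  "active I M = {v \<in> verts I. M v \<noteq> 0}"

definition edge_pass :: "ising \<Rightarrow> nat set \<Rightarrow> (nat \<Rightarrow> int) \<Rightarrow> (nat \<Rightarrow> int) \<Rightarrow> nat set \<Rightarrow> real" where
  "edge_pass I S \<sigma> \<tau> e = pass_prob (beta I e) (e \<subseteq> S) (\<Prod>v\<in>e. \<sigma> v) (\<Prod>v\<in>e. \<tau> v)"

definition resample :: "nat set \<Rightarrow> (nat \<Rightarrow> int) \<Rightarrow> (nat \<Rightarrow> int) pmf" where
  "resample S \<sigma> = map_pmf (\<lambda>Y. override_on \<sigma> Y S) (Pi_pmf S 1 (\<lambda>_. spin_pmf (1 / 2)))"

definition failures :: "ising \<Rightarrow> nat set \<Rightarrow> (nat \<Rightarrow> int) \<Rightarrow> (nat \<Rightarrow> int) \<Rightarrow> nat set set pmf" where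
  "failures I S \<sigma> \<tau> =
     map_pmf (\<lambda>F. {e \<in> touching I S. F e})
       (Pi_pmf (touching I S) False (\<lambda>e. bernoulli_pmf (1 - edge_pass I S \<sigma> \<tau> e)))"

text \<open>A round as one transition of a Markov chain: memories matter only through the set of
  vertices where they are nonzero, so that set replaces them in the state.\<close>

definition step :: "ising \<Rightarrow> (nat \<Rightarrow> int) \<times> nat set \<Rightarrow> ((nat \<Rightarrow> int) \<times> nat set) pmf" where
  "step I = (\<lambda>(\<sigma>, S). bind_pmf (resample S \<sigma>) (\<lambda>\<tau>. map_pmf (\<lambda>A. (\<tau>, \<Union>A)) (failures I S \<sigma> \<tau>)))"

definition encode :: "(nat \<Rightarrow> int) \<times> nat set \<Rightarrow> state" where
  "encode = (\<lambda>(\<sigma>, S). (\<sigma>, \<lambda>v. if v \<in> S then 1 else 0))"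

definition round_cost :: "ising \<Rightarrow> nat set \<Rightarrow> nat" where
  "round_cost I S = card S + card (touching I S)"

lemma finite_edges: "ising_model I \<Longrightarrow> finite (edges I)"
  by (rule finite_subset[of _ "Pow (verts I)"]) (auto simp: ising_model_def)

lemma finite_touching: "ising_model I \<Longrightarrow> finite (touching I S)"
  by (simp add: touching_def finite_edges)

section \<open>Reduction of a round to a step of the chain\<close>

lemma halted_resampler: "halted resampler I (X, M) \<longleftrightarrow> active I M = {}"
  by (auto simp: halted_def resampler_def active_def)

lemma sampled_verts_resampler: "sampled_verts resampler I (X, M) = active I M"
  by (auto simp: sampled_verts_def resampler_def active_def spin_law_def view_def nbhd_def
      simp del: not_None_eq split: if_splits)

lemma spin_law_resampler: "v \<in> active I M \<Longrightarrow> spin_law resampler I (X, M) v = Some (1 / 2)"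
  by (auto simp: resampler_def active_def spin_law_def view_def nbhd_def)

lemma flag_law_resampler:
  assumes "ising_model I" "e \<in> edges I"
  shows "flag_law resampler I (X, M) Y e =
    (if e \<in> touching I (active I M) then Some (1 - edge_pass I (active I M) X Y e) else None)"
proof -
  have e: "e \<subseteq> verts I"
    using assms by (auto simp: ising_model_def)
  have "(\<forall>v\<in>e. view e M v = Some 0) \<longleftrightarrow> e \<notin> touching I (active I M)"
    using e assms by (auto simp: view_def touching_def active_def)
  moreover have "(\<forall>v\<in>e. view e M v \<noteq> Some 0) \<longleftrightarrow> e \<subseteq> active I M"
    using e by (auto simp: view_def active_def)
  moreover have "(\<Prod>v\<in>e. the (view e Z v)) = (\<Prod>v\<in>e. Z v)" for Z :: "nat \<Rightarrow> int"
    by (rule prod.cong) (auto simp: view_def)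
  ultimately show ?thesis
    by (auto simp: flag_law_def resampler_def edge_pass_def)
qed

lemma sampled_edges_resampler:
  "ising_model I \<Longrightarrow> sampled_edges resampler I (X, M) Y = touching I (active I M)"
  by (auto simp: sampled_edges_def flag_law_resampler touching_def)

lemma new_mem_resampler:
  assumes "T \<subseteq> edges I"
  shows "new_mem resampler I (X, M) Y (view T F) = (\<lambda>v. if v \<in> \<Union>{e \<in> T. F e} then 1 else 0)"
proof
  fix v
  have "Some True \<in> range (view T F |` incident I v) \<longleftrightarrow> v \<in> \<Union>{e \<in> T. F e}"
    using assms by (auto simp: image_iff view_def restrict_map_def incident_def split: if_splits)
  thus "new_mem resampler I (X, M) Y (view T F) v = (if v \<in> \<Union>{e \<in> T. F e} then 1 else 0)"
    by (simp add: new_mem_def resampler_def)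
qed

text \<open>The number of draws is a function of the active set alone, so it splits off from the
  random part of the round.\<close>

lemma round_pmf_resampler:
  assumes "ising_model I"
  shows "round_pmf resampler I (X, M) =
    map_pmf (\<lambda>x. (encode x, round_cost I (active I M))) (step I (X, active I M))"
proof -
  let ?S = "active I M" and ?T = "touching I (active I M)"
  have 1: "Pi_pmf ?S 1 (\<lambda>v. spin_pmf (the (spin_law resampler I (X, M) v)))
      = Pi_pmf ?S 1 (\<lambda>_. spin_pmf (1 / 2))"
    by (rule Pi_pmf_cong) (auto simp: spin_law_resampler)
  have 2: "Pi_pmf ?T False (\<lambda>e. bernoulli_pmf (the (flag_law resampler I (X, M) Y e)))
      = Pi_pmf ?T False (\<lambda>e. bernoulli_pmf (1 - edge_pass I ?S X Y e))" for Y
    by (rule Pi_pmf_cong) (auto simp: flag_law_resampler[OF assms] touching_def)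
  have 3: "new_mem resampler I (X, M) Y (view ?T F)
      = (\<lambda>v. if v \<in> \<Union>{e \<in> ?T. F e} then 1 else 0)" for Y F
    by (rule new_mem_resampler) (auto simp: touching_def)
  show ?thesis
    unfolding round_pmf_def Let_def sampled_verts_resampler sampled_edges_resampler[OF assms]
      1 2 3 step_def resample_def failures_def encode_def round_cost_def
    by (simp add: map_bind_pmf bind_map_pmf map_pmf_def[symmetric] pmf.map_comp o_def
        bind_return_pmf bind_assoc_pmf)
qed

lemma active_encode: "S \<subseteq> verts I \<Longrightarrow> active I (snd (encode (\<sigma>, S))) = S"
  by (auto simp: active_def encode_def)

definition chain_run where
  "chain_run I x = run resampler I (encode x)"

lemma run_resampler:
  assumes "ising_model I"
  shows "run resampler I (X, M) =
    (if active I M = {} then return_spmf (X, 0, 0)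
     else bind_spmf (spmf_of_pmf (step I (X, active I M)))
       (\<lambda>x. map_spmf (\<lambda>(\<sigma>, r, n). (\<sigma>, Suc r, round_cost I (active I M) + n)) (chain_run I x)))"
  by (subst run.simps)
    (simp add: halted_resampler round_pmf_resampler[OF assms] chain_run_def
      flip: map_spmf_of_pmf add: bind_map_spmf o_def)

text \<open>The initial memory may be nonzero outside the graph. Only its active part enters the
  recursion for \<open>run\<close>, so the encoding of the active set can replace it.\<close>

lemma run_resampler_eq_chain_run:
  assumes "ising_model I"
  shows "run resampler I (X, M) = chain_run I (X, active I M)"
proof -
  have "active I (snd (encode (X, active I M))) = active I M"
    by (rule active_encode) (auto simp: active_def)
  thus ?thesis
    unfolding chain_run_def encode_def by (simp add: run_resampler[OF assms])
qed

lemma chain_run_unfold: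
  assumes "ising_model I" "S \<subseteq> verts I"
  shows "chain_run I (\<sigma>, S) =
    (if S = {} then return_spmf (\<sigma>, 0, 0)
     else bind_spmf (spmf_of_pmf (step I (\<sigma>, S)))
       (\<lambda>x. map_spmf (\<lambda>(\<sigma>, r, n). (\<sigma>, Suc r, round_cost I S + n)) (chain_run I x)))"
  using active_encode[OF assms(2), of \<sigma>]
  by (subst chain_run_def) (simp add: encode_def run_resampler[OF assms(1)])

section \<open>Spin flips and the conditional Gibbs property\<close>

definition flip :: "nat \<Rightarrow> (nat \<Rightarrow> int) \<Rightarrow> nat \<Rightarrow> int" where
  "flip v \<sigma> = \<sigma>(v := - \<sigma> v)"

lemma flip_flip [simp]: "flip v (flip v \<sigma>) = \<sigma>"
  by (simp add: flip_def)

lemma flip_in_configs_iff [simp]: "v \<in> verts I \<Longrightarrow> flip v \<sigma> \<in> configs I \<longleftrightarrow> \<sigma> \<in> configs I"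
  by (auto simp: configs_def flip_def PiE_def Pi_def extensional_def split: if_splits)

lemma bij_betw_flip: "v \<in> verts I \<Longrightarrow> bij_betw (flip v) (configs I) (configs I)"
  by (rule bij_betwI[of _ _ _ "flip v"]) auto

lemma prod_flip:
  assumes "finite e"
  shows "(\<Prod>u\<in>e. flip v \<sigma> u) = (if v \<in> e then - (\<Prod>u\<in>e. \<sigma> u) else (\<Prod>u\<in>e. \<sigma> u))"
proof (cases "v \<in> e")
  case True
  have "(\<Prod>u\<in>e. flip v \<sigma> u) = flip v \<sigma> v * (\<Prod>u\<in>e - {v}. flip v \<sigma> u)"
    by (rule prod.remove[OF assms True])
  also have "(\<Prod>u\<in>e - {v}. flip v \<sigma> u) = (\<Prod>u\<in>e - {v}. \<sigma> u)"
    by (rule prod.cong) (auto simp: flip_def)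
  also have "flip v \<sigma> v * \<dots> = - (\<Prod>u\<in>e. \<sigma> u)"
    using prod.remove[OF assms True, of \<sigma>] by (simp add: flip_def)
  finally show ?thesis
    using True by simp
next
  case False
  thus ?thesis
    by (auto simp: flip_def intro!: prod.cong)
qed

lemma spin_prod_cases:
  assumes "ising_model I" "e \<in> edges I" "\<sigma> \<in> configs I"
  shows "(\<Prod>u\<in>e. \<sigma> u) = 1 \<or> (\<Prod>u\<in>e. \<sigma> u) = -1"
proof -
  have e: "e \<subseteq> verts I" "finite e"
    using assms finite_subset by (auto simp: ising_model_def)
  have "\<forall>u\<in>e. \<sigma> u \<in> {-1, 1}"
    using assms e by (auto simp: configs_def PiE_def Pi_def)
  with e(2) show ?thesis
    by (induction e rule: finite_induct) auto
qed

section \<open>Edge factors and pass probabilities\<close>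

lemma edge_factor_pos [simp]: "edge_factor b x > 0"
  by (simp add: edge_factor_def)

lemma edge_factor_nonneg [simp]: "edge_factor b x \<ge> 0"
  by (simp add: edge_factor_def)

lemma edge_factor_nonzero [simp]: "edge_factor b x \<noteq> 0"
  by (simp add: edge_factor_def)

text \<open>A spin product agrees with the sign of the coupling or opposes it, and a sign change
  exchanges the two. Splitting by value spares later proofs a split by the sign of
  \<open>b\<close>.\<close>

lemma edge_factor_cases:
  assumes "x = 1 \<or> x = -1"
  obtains "edge_factor b x = 1" "edge_factor b (- x) = exp (- 2 * \<bar>b\<bar>)"
  | "edge_factor b x = exp (- 2 * \<bar>b\<bar>)" "edge_factor b (- x) = 1"
  using assms by (cases "b \<ge> 0") (auto simp: edge_factor_def)

lemma edge_factor_bounds: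
  assumes "x = 1 \<or> x = -1"
  shows "edge_factor b x \<le> 1" "exp (- 2 * \<bar>b\<bar>) \<le> edge_factor b x"
  by (rule edge_factor_cases[OF assms, of b]; simp)+

text \<open>The numerator \<open>exp (- 2 * \<bar>b\<bar>)\<close> is the minimum of the edge factor
  over the two spin products, so its quotient by the old factor stays at most 1.\<close>

lemma pass_prob_bounds:
  assumes "x = 1 \<or> x = -1" "y = 1 \<or> y = -1"
  shows "0 \<le> pass_prob b internal x y" "pass_prob b internal x y \<le> 1"
proof -
  show "0 \<le> pass_prob b internal x y"
    by (simp add: pass_prob_def)
  have "exp (- 2 * \<bar>b\<bar>) / edge_factor b x * edge_factor b y \<le> 1 * 1"
    using edge_factor_bounds[OF assms(1), of b] edge_factor_bounds[OF assms(2), of b]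
    by (intro mult_mono) auto
  thus "pass_prob b internal x y \<le> 1"
    using edge_factor_bounds[OF assms(2), of b] by (auto simp: pass_prob_def)
qed

lemma edge_pass_bounds:
  assumes "ising_model I" "e \<in> edges I" "\<sigma> \<in> configs I" "\<tau> \<in> configs I"
  shows "0 \<le> edge_pass I S \<sigma> \<tau> e" "edge_pass I S \<sigma> \<tau> e \<le> 1"
  unfolding edge_pass_def by (intro pass_prob_bounds spin_prod_cases[OF assms(1,2)] assms(3,4))+

lemma weight_edge_factor:
  "weight I \<sigma> = (\<Prod>e\<in>edges I. exp \<bar>beta I e\<bar>) * (\<Prod>e\<in>edges I. edge_factor (beta I e) (\<Prod>v\<in>e. \<sigma> v))"
  by (simp add: weight_def edge_factor_def flip: prod.distrib exp_add)

text \<open>\<open>y0\<close> may lie outside the support; then no support point maps to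
  \<open>x\<close> and both sides vanish.\<close>

lemma pmf_map_eq_pmf:
  assumes "\<And>y. y \<in> set_pmf M \<Longrightarrow> f y = x \<longleftrightarrow> y = y0"
  shows "pmf (map_pmf f M) x = pmf M y0"
proof -
  have "pmf (map_pmf f M) x = measure (measure_pmf M) ({y. f y = x} \<inter> set_pmf M)"
    by (simp add: pmf_map measure_Int_set_pmf vimage_def)
  also have "{y. f y = x} \<inter> set_pmf M = {y0} \<inter> set_pmf M"
    using assms by auto
  also have "measure (measure_pmf M) \<dots> = pmf M y0"
    by (simp add: measure_Int_set_pmf measure_pmf_single)
  finally show ?thesis .
qed

section \<open>Point probabilities of one step\<close>

lemma pmf_spin_pmf_half: "pmf (spin_pmf (1 / 2)) x = (if x = -1 \<or> x = 1 then 1 / 2 else 0)"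
proof -
  consider "x = 1" | "x = -1" | "x \<noteq> 1" "x \<noteq> -1" by blast
  thus ?thesis
  proof cases
    case 1
    have "pmf (spin_pmf (1 / 2)) x = pmf (bernoulli_pmf (1 / 2)) True"
      unfolding spin_pmf_def by (rule pmf_map_eq_pmf) (use 1 in auto)
    thus ?thesis using 1 by simp
  next
    case 2
    have "pmf (spin_pmf (1 / 2)) x = pmf (bernoulli_pmf (1 / 2)) False"
      unfolding spin_pmf_def by (rule pmf_map_eq_pmf) (use 2 in auto)
    thus ?thesis using 2 by simp
  next
    case 3
    hence "x \<notin> set_pmf (spin_pmf (1 / 2))"
      by (auto simp: spin_pmf_def)
    thus ?thesis using 3 by (simp add: pmf_eq_0_set_pmf)
  qed
qed

lemma pmf_resample:
  assumes "finite S"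
  shows "pmf (resample S \<sigma>) \<tau> =
    (if (\<forall>u\<in>S. \<tau> u = -1 \<or> \<tau> u = 1) \<and> (\<forall>u. u \<notin> S \<longrightarrow> \<tau> u = \<sigma> u) then (1 / 2) ^ card S else 0)"
proof (cases "\<forall>u. u \<notin> S \<longrightarrow> \<tau> u = \<sigma> u")
  case True
  \<comment> \<open>The only possible preimage: \<open>Pi_pmf\<close> fixes the default value 1 off
    \<open>S\<close>.\<close>
  let ?Y = "\<lambda>u. if u \<in> S then \<tau> u else 1"
  have "pmf (resample S \<sigma>) \<tau> = pmf (Pi_pmf S 1 (\<lambda>_. spin_pmf (1 / 2))) ?Y"
    unfolding resample_def
  proof (rule pmf_map_eq_pmf)
    fix Y assume "Y \<in> set_pmf (Pi_pmf S 1 (\<lambda>_. spin_pmf (1 / 2)))"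
    hence out: "Y u = 1" if "u \<notin> S" for u
      using that set_Pi_pmf_subset[OF assms, of 1] by blast
    show "override_on \<sigma> Y S = \<tau> \<longleftrightarrow> Y = ?Y"
    proof
      assume "override_on \<sigma> Y S = \<tau>"
      hence "Y u = \<tau> u" if "u \<in> S" for u
        using that by auto
      thus "Y = ?Y" using out by (intro ext) simp
    next
      assume "Y = ?Y"
      thus "override_on \<sigma> Y S = \<tau>"
        using True by (intro ext) (simp add: override_on_def)
    qed
  qed
  also have "\<dots> = (\<Prod>u\<in>S. pmf (spin_pmf (1 / 2)) (\<tau> u))"
    by (subst pmf_Pi'[OF assms]) auto
  also have "\<dots> = (if \<forall>u\<in>S. \<tau> u = -1 \<or> \<tau> u = 1 then (1 / 2) ^ card S else 0)"
    using assms by (auto simp: pmf_spin_pmf_half intro!: prod_zero)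
  finally show ?thesis
    using True by simp
next
  case False
  hence "\<tau> \<notin> set_pmf (resample S \<sigma>)"
    by (auto simp: resample_def override_on_def)
  thus ?thesis
    using False by (auto simp: pmf_eq_0_set_pmf)
qed

lemma resample_in_configs:
  assumes "ising_model I" "S \<subseteq> verts I" "\<sigma> \<in> configs I" "\<tau> \<in> set_pmf (resample S \<sigma>)"
  shows "\<tau> \<in> configs I"
proof -
  have "finite S"
    using assms finite_subset by (auto simp: ising_model_def)
  from assms(4) have "(\<forall>u\<in>S. \<tau> u = -1 \<or> \<tau> u = 1) \<and> (\<forall>u. u \<notin> S \<longrightarrow> \<tau> u = \<sigma> u)"
    by (simp add: set_pmf_iff pmf_resample[OF \<open>finite S\<close>] split: if_splits)
  thus ?thesis
    using assms(2,3) by (fastforce simp: configs_def PiE_def Pi_def extensional_def)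
qed

lemma pmf_failures:
  assumes "ising_model I" "\<sigma> \<in> configs I" "\<tau> \<in> configs I" "A \<subseteq> touching I S"
  shows "pmf (failures I S \<sigma> \<tau>) A =
    (\<Prod>e\<in>touching I S. if e \<in> A then 1 - edge_pass I S \<sigma> \<tau> e else edge_pass I S \<sigma> \<tau> e)"
proof -
  let ?T = "touching I S"
  let ?p = "Pi_pmf ?T False (\<lambda>e. bernoulli_pmf (1 - edge_pass I S \<sigma> \<tau> e))"
  note fin = finite_touching[OF assms(1), of S]
  have "pmf (failures I S \<sigma> \<tau>) A = pmf ?p (\<lambda>e. e \<in> A)"
    unfolding failures_def
  proof (rule pmf_map_eq_pmf)
    fix F assume "F \<in> set_pmf ?p"
    hence "\<forall>e. e \<notin> ?T \<longrightarrow> F e = False"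
      using set_Pi_pmf_subset[OF fin, of False] by blast
    thus "{e \<in> ?T. F e} = A \<longleftrightarrow> F = (\<lambda>e. e \<in> A)"
      using assms(4) by (auto simp: fun_eq_iff)
  qed
  also have "\<dots> = (\<Prod>e\<in>?T. pmf (bernoulli_pmf (1 - edge_pass I S \<sigma> \<tau> e)) (e \<in> A))"
    using assms(4) by (subst pmf_Pi'[OF fin]) auto
  also have "\<dots> = (\<Prod>e\<in>?T. if e \<in> A then 1 - edge_pass I S \<sigma> \<tau> e else edge_pass I S \<sigma> \<tau> e)"
  proof (rule prod.cong[OF refl])
    fix e assume "e \<in> ?T"
    hence "e \<in> edges I" by (simp add: touching_def)
    from edge_pass_bounds[OF assms(1) this assms(2,3), of S]
    show "pmf (bernoulli_pmf (1 - edge_pass I S \<sigma> \<tau> e)) (e \<in> A)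
      = (if e \<in> A then 1 - edge_pass I S \<sigma> \<tau> e else edge_pass I S \<sigma> \<tau> e)"
      by simp
  qed
  finally show ?thesis .
qed

lemma set_failures: "set_pmf (failures I S \<sigma> \<tau>) \<subseteq> Pow (touching I S)"
  by (auto simp: failures_def)

text \<open>The outcome records the new spins, so a single resampling result contributes. The failed
  edges are not recorded, so all sets of them with the same union are summed.\<close>

lemma pmf_step:
  assumes "ising_model I"
  shows "pmf (step I (\<sigma>, S)) (\<tau>, S') = pmf (resample S \<sigma>) \<tau> *
    (\<Sum>A | A \<subseteq> touching I S \<and> \<Union>A = S'. pmf (failures I S \<sigma> \<tau>) A)"
proof -
  let ?f = "\<lambda>\<tau>'. pmf (map_pmf (\<lambda>A. (\<tau>', \<Union>A)) (failures I S \<sigma> \<tau>')) (\<tau>, S')"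
  have "pmf (step I (\<sigma>, S)) (\<tau>, S') = (\<integral>\<tau>'. ?f \<tau>' \<partial>resample S \<sigma>)"
    by (simp add: step_def pmf_bind)
  also have "\<dots> = ?f \<tau> * pmf (resample S \<sigma>) \<tau>"
  proof (subst integral_measure_pmf_real[of "{\<tau>}"])
    fix a assume "?f a \<noteq> 0"
    hence "(\<tau>, S') \<in> set_pmf (map_pmf (\<lambda>A. (a, \<Union>A)) (failures I S \<sigma> a))"
      unfolding set_pmf_iff .
    thus "a \<in> {\<tau>}" by auto
  qed auto
  also have "?f \<tau> = measure (failures I S \<sigma> \<tau>) ({A. \<Union>A = S'} \<inter> set_pmf (failures I S \<sigma> \<tau>))"
    by (simp add: pmf_map vimage_def measure_Int_set_pmf)
  also have "{A. \<Union>A = S'} \<inter> set_pmf (failures I S \<sigma> \<tau>)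
      = {A. A \<subseteq> touching I S \<and> \<Union>A = S'} \<inter> set_pmf (failures I S \<sigma> \<tau>)"
    using set_failures by blast
  also have "measure (failures I S \<sigma> \<tau>) \<dots> = (\<Sum>A | A \<subseteq> touching I S \<and> \<Union>A = S'. pmf (failures I S \<sigma> \<tau>) A)"
    unfolding measure_Int_set_pmf
    by (rule measure_measure_pmf_finite) (auto intro: finite_subset[OF _ finite_Pow_iff[THEN iffD2, OF finite_touching[OF assms, of S]]])
  finally show ?thesis by simp
qed

text \<open>Balance holds edge by edge. All touched edges at \<open>v\<close> pass, because
  \<open>v\<close> avoids \<open>\<Union>A\<close>, and for fixed old spins a pass probability is
  proportional to the new edge factor. If \<open>v\<close> is inactive, the old factor in the
  denominator of the pass probability cancels against the weight of the old spins.\<close>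

lemma failures_flip:
  assumes I: "ising_model I" and \<sigma>: "\<sigma> \<in> configs I" and \<tau>: "\<tau> \<in> configs I"
    and v: "v \<in> verts I" "v \<notin> \<Union>A" and A: "A \<subseteq> touching I S"
    and agree: "\<And>u. u \<notin> S \<Longrightarrow> \<tau> u = \<sigma> u"
  defines "\<rho> \<equiv> if v \<in> S then \<sigma> else flip v \<sigma>"
  shows "pmf (failures I S \<rho> (flip v \<tau>)) A * (weight I \<rho> * weight I \<tau>) =
    pmf (failures I S \<sigma> \<tau>) A * (weight I \<sigma> * weight I (flip v \<tau>))"
proof -
  let ?\<phi> = "\<lambda>\<sigma> e. edge_factor (beta I e) (\<Prod>v\<in>e. \<sigma> v)"
  \<comment> \<open>Extended by 1 to untouched edges, so that its product runs over the same edges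
    as the weights.\<close>
  let ?g = "\<lambda>\<sigma> \<tau> e. if e \<in> touching I S
    then if e \<in> A then 1 - edge_pass I S \<sigma> \<tau> e else edge_pass I S \<sigma> \<tau> e else 1"
  have \<rho>: "\<rho> \<in> configs I"
    using v \<sigma> by (simp add: \<rho>_def)
  have T: "touching I S = edges I \<inter> touching I S"
    by (auto simp: touching_def)
  have g: "pmf (failures I S \<sigma> \<tau>) A = prod (?g \<sigma> \<tau>) (edges I)"
    if "\<sigma> \<in> configs I" "\<tau> \<in> configs I" for \<sigma> \<tau>
    unfolding pmf_failures[OF I that A] by (subst T, subst prod.inter_restrict) (auto simp: finite_edges I)
  have key: "?g \<rho> (flip v \<tau>) e * (?\<phi> \<rho> e * ?\<phi> \<tau> e) = ?g \<sigma> \<tau> e * (?\<phi> \<sigma> e * ?\<phi> (flip v \<tau>) e)"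
    if e: "e \<in> edges I" for e
  proof -
    have fin: "finite e"
      using I e finite_subset by (auto simp: ising_model_def)
    show ?thesis
    proof (cases "v \<in> e")
      case False
      hence "(\<Prod>u\<in>e. \<rho> u) = (\<Prod>u\<in>e. \<sigma> u)" "(\<Prod>u\<in>e. flip v \<tau> u) = (\<Prod>u\<in>e. \<tau> u)"
        by (simp_all add: \<rho>_def prod_flip[OF fin])
      thus ?thesis by (simp add: edge_pass_def)
    next
      case ve: True
      hence eA: "e \<notin> A" using v by auto
      show ?thesis
      proof (cases "e \<in> touching I S")
        case True
        show ?thesis
        proof (cases "v \<in> S")
          case vS: True
          thus ?thesis using True eA by (simp add: \<rho>_def edge_pass_def pass_prob_def)
        next
          case vS: False
          hence "\<not> e \<subseteq> S" using ve by auto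
          thus ?thesis using True eA vS
            by (simp add: edge_pass_def pass_prob_def field_simps)
        qed
      next
        case False
        \<comment> \<open>An untouched edge keeps its spin product, so flipping the old and the new
          spin changes both factors alike.\<close>
        hence *: "e \<inter> S = {}" using e by (auto simp: touching_def)
        hence "(\<Prod>u\<in>e. \<tau> u) = (\<Prod>u\<in>e. \<sigma> u)"
          using agree by (intro prod.cong) auto
        moreover have "v \<notin> S" using * ve by auto
        ultimately show ?thesis using False
          by (simp add: \<rho>_def prod_flip[OF fin])
      qed
    qed
  qed
  have "prod (?g \<rho> (flip v \<tau>)) (edges I) * (prod (?\<phi> \<rho>) (edges I) * prod (?\<phi> \<tau>) (edges I)) =
    prod (?g \<sigma> \<tau>) (edges I) * (prod (?\<phi> \<sigma>) (edges I) * prod (?\<phi> (flip v \<tau>)) (edges I))"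
    unfolding prod.distrib[symmetric] by (rule prod.cong[OF refl key])
  thus ?thesis
    using \<sigma> \<tau> \<rho> v by (simp add: g weight_edge_factor)
qed

text \<open>Uniform resampling does not notice the flip, and \<open>failures_flip\<close> is summed
  over the sets of failed edges. Inactivity of \<open>v\<close> after the step guarantees that no
  edge at \<open>v\<close> has failed.\<close>

lemma step_flip:
  assumes I: "ising_model I" and \<sigma>: "\<sigma> \<in> configs I" and \<tau>: "\<tau> \<in> configs I"
    and S: "S \<subseteq> verts I" and v: "v \<in> verts I" "v \<notin> S'"
  defines "\<rho> \<equiv> if v \<in> S then \<sigma> else flip v \<sigma>"
  shows "pmf (step I (\<rho>, S)) (flip v \<tau>, S') * (weight I \<rho> * weight I \<tau>) =
    pmf (step I (\<sigma>, S)) (\<tau>, S') * (weight I \<sigma> * weight I (flip v \<tau>))"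
proof -
  have S_fin: "finite S"
    using I S finite_subset by (auto simp: ising_model_def)
  have "(\<forall>u\<in>S. flip v \<tau> u = -1 \<or> flip v \<tau> u = 1) \<longleftrightarrow> (\<forall>u\<in>S. \<tau> u = -1 \<or> \<tau> u = 1)"
    by (auto simp: flip_def)
  moreover have "(\<forall>u. u \<notin> S \<longrightarrow> flip v \<tau> u = \<rho> u) \<longleftrightarrow> (\<forall>u. u \<notin> S \<longrightarrow> \<tau> u = \<sigma> u)"
    by (auto simp: flip_def \<rho>_def)
  ultimately have r: "pmf (resample S \<rho>) (flip v \<tau>) = pmf (resample S \<sigma>) \<tau>"
    by (simp add: pmf_resample[OF S_fin])
  show ?thesis
  proof (cases "\<forall>u. u \<notin> S \<longrightarrow> \<tau> u = \<sigma> u")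
    case True
    have "pmf (failures I S \<rho> (flip v \<tau>)) A * (weight I \<rho> * weight I \<tau>) =
        pmf (failures I S \<sigma> \<tau>) A * (weight I \<sigma> * weight I (flip v \<tau>))"
      if "A \<in> {A. A \<subseteq> touching I S \<and> \<Union>A = S'}" for A
      unfolding \<rho>_def by (rule failures_flip[OF I \<sigma> \<tau> v(1)]) (use that v True in auto)
    hence "(\<Sum>A | A \<subseteq> touching I S \<and> \<Union>A = S'. pmf (failures I S \<rho> (flip v \<tau>)) A)
          * (weight I \<rho> * weight I \<tau>) =
        (\<Sum>A | A \<subseteq> touching I S \<and> \<Union>A = S'. pmf (failures I S \<sigma> \<tau>) A)
          * (weight I \<sigma> * weight I (flip v \<tau>))"
      unfolding sum_distrib_right by (rule sum.cong[OF refl])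
    thus ?thesis
      by (simp add: pmf_step[OF I] r mult.assoc)
  next
    case False
    hence "pmf (resample S \<sigma>) \<tau> = 0"
      unfolding pmf_resample[OF S_fin] by auto
    thus ?thesis
      by (simp add: pmf_step[OF I] r)
  qed
qed

text \<open>Conditional Gibbs laws given the active spins are characterised by detailed balance under
  single flips of inactive vertices; edges avoiding the flipped vertex cancel in the weights.\<close>

definition conditionally_gibbs :: "ising \<Rightarrow> ((nat \<Rightarrow> int) \<times> nat set) pmf \<Rightarrow> bool" where
  "conditionally_gibbs I \<mu> \<longleftrightarrow> set_pmf \<mu> \<subseteq> configs I \<times> Pow (verts I) \<and>
     (\<forall>S v. \<forall>\<sigma>\<in>configs I. v \<in> verts I - S \<longrightarrow>
        pmf \<mu> (flip v \<sigma>, S) * weight I \<sigma> = pmf \<mu> (\<sigma>, S) * weight I (flip v \<sigma>))"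

lemma set_step:
  assumes "ising_model I" "\<sigma> \<in> configs I" "S \<subseteq> verts I"
  shows "set_pmf (step I (\<sigma>, S)) \<subseteq> configs I \<times> Pow (verts I)"
proof -
  have "\<Union>A \<subseteq> verts I" if "A \<in> set_pmf (failures I S \<sigma> \<tau>)" for A \<tau>
    using that set_failures[of I S \<sigma> \<tau>] assms(1) by (fastforce simp: touching_def ising_model_def)
  thus ?thesis
    using resample_in_configs[OF assms(1,3,2)] by (fastforce simp: step_def)
qed

lemma finite_states: "ising_model I \<Longrightarrow> finite (configs I \<times> Pow (verts I))"
  using finite_configs[of I] by (auto simp: ising_model_def)

text \<open>Old states leading to \<open>\<tau>\<close> are matched one to one with old states
  leading to \<open>flip v \<tau>\<close>. Multiplying the balance of \<open>\<mu>\<close> by that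
  of \<open>step_flip\<close> makes matched terms agree.\<close>

lemma conditionally_gibbs_step:
  assumes I: "ising_model I" and cg: "conditionally_gibbs I \<mu>"
  shows "conditionally_gibbs I (bind_pmf \<mu> (step I))"
proof -
  let ?\<Omega> = "configs I \<times> Pow (verts I)"
  have supp: "set_pmf \<mu> \<subseteq> ?\<Omega>"
    and bal: "\<And>S v \<sigma>. \<sigma> \<in> configs I \<Longrightarrow> v \<in> verts I \<Longrightarrow> v \<notin> S \<Longrightarrow>
        pmf \<mu> (flip v \<sigma>, S) * weight I \<sigma> = pmf \<mu> (\<sigma>, S) * weight I (flip v \<sigma>)"
    using cg by (auto simp: conditionally_gibbs_def)
  have bind: "pmf (bind_pmf \<mu> (step I)) y = (\<Sum>x\<in>?\<Omega>. pmf (step I x) y * pmf \<mu> x)" for y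
    unfolding pmf_bind by (rule integral_measure_pmf_real[OF finite_states[OF I]]) (use supp in auto)
  show ?thesis
    unfolding conditionally_gibbs_def
  proof (intro conjI allI ballI impI)
    show "set_pmf (bind_pmf \<mu> (step I)) \<subseteq> ?\<Omega>"
    proof -
      have "set_pmf (step I (\<sigma>, S)) \<subseteq> ?\<Omega>" if "(\<sigma>, S) \<in> set_pmf \<mu>" for \<sigma> S
        by (rule set_step[OF I]) (use that supp in auto)
      thus ?thesis
        unfolding set_bind_pmf by (intro UN_least) (metis prod.collapse)
    qed
  next
    fix S' v \<tau> assume \<tau>: "\<tau> \<in> configs I" and v': "v \<in> verts I - S'"
    hence v: "v \<in> verts I" "v \<notin> S'" by auto
    \<comment> \<open>If \<open>v\<close> is active, its old spin is forgotten; if not, it is carried over to \<open>\<tau>\<close> and must be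
      flipped along.\<close>
    let ?\<theta> = "\<lambda>(\<sigma>, S). (if v \<in> S then \<sigma> else flip v \<sigma>, S)"
    have "(\<Sum>x\<in>?\<Omega>. pmf (step I x) (\<tau>, S') * pmf \<mu> x * weight I (flip v \<tau>)) =
      (\<Sum>x\<in>?\<Omega>. pmf (step I x) (flip v \<tau>, S') * pmf \<mu> x * weight I \<tau>)"
    proof (rule sum.reindex_bij_witness[of _ ?\<theta> ?\<theta>])
      fix x assume x: "x \<in> ?\<Omega>"
      obtain \<sigma> S where xs: "x = (\<sigma>, S)" by force
      let ?\<rho> = "if v \<in> S then \<sigma> else flip v \<sigma>"
      have *: "\<sigma> \<in> configs I" "S \<subseteq> verts I" using x xs by auto
      show "?\<theta> (?\<theta> x) = x" by (simp add: xs)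
      show "?\<theta> x \<in> ?\<Omega>" using * v by (simp add: xs)
      have 1: "pmf \<mu> (?\<rho>, S) * weight I \<sigma> = pmf \<mu> (\<sigma>, S) * weight I ?\<rho>"
        using bal[OF *(1) v(1), of S] by auto
      have 2: "pmf (step I (?\<rho>, S)) (flip v \<tau>, S') * (weight I ?\<rho> * weight I \<tau>) =
          pmf (step I (\<sigma>, S)) (\<tau>, S') * (weight I \<sigma> * weight I (flip v \<tau>))"
        by (rule step_flip[OF I *(1) \<tau> *(2) v])
      have w: "weight I \<sigma> * weight I ?\<rho> \<noteq> 0"
        using weight_pos[of I \<sigma>] weight_pos[of I ?\<rho>] by auto
      have alg: "k' * p' * t = k * p * t'"
        if "p' * a = p * b" "k' * (b * t) = k * (a * t')" "a * b \<noteq> 0" for a b p p' k k' t t' :: real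
      proof -
        have "(k' * p' * t) * (a * b) = (k' * (b * t)) * (p' * a)" by simp
        also have "\<dots> = (k * p * t') * (a * b)" unfolding that by simp
        finally show ?thesis using that(3) by simp
      qed
      show "pmf (step I (?\<theta> x)) (flip v \<tau>, S') * pmf \<mu> (?\<theta> x) * weight I \<tau> =
        pmf (step I x) (\<tau>, S') * pmf \<mu> x * weight I (flip v \<tau>)"
        using alg[OF 1 2 w] by (simp add: xs)
    qed (use v in auto)
    thus "pmf (bind_pmf \<mu> (step I)) (flip v \<tau>, S') * weight I \<tau> =
      pmf (bind_pmf \<mu> (step I)) (\<tau>, S') * weight I (flip v \<tau>)"
      by (simp add: bind sum_distrib_right)
  qed
qed

section \<open>Contraction of the active set\<close>

definition active_mean :: "((nat \<Rightarrow> int) \<times> nat set) pmf \<Rightarrow> real" where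
  "active_mean \<mu> = measure_pmf.expectation \<mu> (\<lambda>x. real (card (snd x)))"

text \<open>The average of \<open>edge_pass\<close> over the new spins when \<open>e\<close> is
  touched: the new spin product is then uniform on the two signs.\<close>

definition mean_pass :: "ising \<Rightarrow> nat set \<Rightarrow> (nat \<Rightarrow> int) \<Rightarrow> nat set \<Rightarrow> real" where
  "mean_pass I S \<sigma> e =
     (if e \<subseteq> S then 1 else exp (- 2 * \<bar>beta I e\<bar>) / edge_factor (beta I e) (\<Prod>v\<in>e. \<sigma> v))
       * ((1 + exp (- 2 * \<bar>beta I e\<bar>)) / 2)"

section \<open>Expected size of the next active set\<close>

lemma finite_set_resample:
  assumes "ising_model I" "S \<subseteq> verts I" "\<sigma> \<in> configs I"
  shows "finite (set_pmf (resample S \<sigma>))"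
  using finite_subset[OF _ finite_configs[OF assms(1)]] resample_in_configs[OF assms] by blast

lemma finite_set_failures: "ising_model I \<Longrightarrow> finite (set_pmf (failures I S \<sigma> \<tau>))"
  by (rule finite_subset[OF set_failures]) (simp add: finite_touching)

lemma resample_flip:
  assumes "finite S" "v \<in> S"
  shows "map_pmf (flip v) (resample S \<sigma>) = resample S \<sigma>"
proof (rule pmf_eqI)
  fix \<tau>
  have "pmf (map_pmf (flip v) (resample S \<sigma>)) \<tau> = pmf (resample S \<sigma>) (flip v \<tau>)"
    by (rule pmf_map_eq_pmf) (metis flip_flip)
  also have "\<dots> = pmf (resample S \<sigma>) \<tau>"
  proof -
    have "(\<forall>u\<in>S. flip v \<tau> u = -1 \<or> flip v \<tau> u = 1) \<longleftrightarrow> (\<forall>u\<in>S. \<tau> u = -1 \<or> \<tau> u = 1)"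
      by (auto simp: flip_def)
    moreover have "(\<forall>u. u \<notin> S \<longrightarrow> flip v \<tau> u = \<sigma> u) \<longleftrightarrow> (\<forall>u. u \<notin> S \<longrightarrow> \<tau> u = \<sigma> u)"
      using assms(2) by (auto simp: flip_def)
    ultimately show ?thesis
      by (simp add: pmf_resample[OF assms(1)])
  qed
  finally show "pmf (map_pmf (flip v) (resample S \<sigma>)) \<tau> = pmf (resample S \<sigma>) \<tau>" .
qed

text \<open>A flip at a resampled endpoint preserves the uniform law and exchanges the two values of
  the new edge factor, so the mean is half the sum over such a pair.\<close>

lemma expectation_edge_pass:
  assumes I: "ising_model I" and S: "S \<subseteq> verts I" and \<sigma>: "\<sigma> \<in> configs I" and e: "e \<in> touching I S"
  shows "measure_pmf.expectation (resample S \<sigma>) (\<lambda>\<tau>. edge_pass I S \<sigma> \<tau> e) = mean_pass I S \<sigma> e"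
proof -
  let ?E = "measure_pmf.expectation (resample S \<sigma>)" and ?f = "\<lambda>\<tau>. edge_pass I S \<sigma> \<tau> e"
  obtain v where v: "v \<in> e" "v \<in> S" and e': "e \<in> edges I"
    using e by (auto simp: touching_def)
  have fin: "finite S" "finite e"
    using I S e' finite_subset by (auto simp: ising_model_def)
  have int: "integrable (resample S \<sigma>) g" for g :: "_ \<Rightarrow> real"
    by (rule integrable_measure_pmf_finite[OF finite_set_resample[OF I S \<sigma>]])
  have "?E ?f = measure_pmf.expectation (map_pmf (flip v) (resample S \<sigma>)) ?f"
    by (simp add: resample_flip[OF fin(1) v(2)])
  hence "?E ?f = ?E (\<lambda>\<tau>. ?f (flip v \<tau>))"
    by simp
  hence "2 * ?E ?f = ?E (\<lambda>\<tau>. ?f \<tau> + ?f (flip v \<tau>))"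
    using int by simp
  also have "\<dots> = ?E (\<lambda>\<tau>. 2 * mean_pass I S \<sigma> e)"
  proof (rule integral_cong_AE, simp, simp, rule AE_pmfI)
    fix \<tau> assume "\<tau> \<in> set_pmf (resample S \<sigma>)"
    hence "\<tau> \<in> configs I"
      by (rule resample_in_configs[OF I S \<sigma>])
    from spin_prod_cases[OF I e' this]
    show "?f \<tau> + ?f (flip v \<tau>) = 2 * mean_pass I S \<sigma> e"
      by (rule edge_factor_cases[of _ "beta I e"])
        (use v in \<open>simp_all add: edge_pass_def pass_prob_def mean_pass_def prod_flip[OF fin(2)] field_simps\<close>)
  qed
  finally show ?thesis by simp
qed

lemma prob_in_failures:
  assumes "ising_model I" "\<sigma> \<in> configs I" "\<tau> \<in> configs I" "e \<in> touching I S"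
  shows "measure_pmf.expectation (failures I S \<sigma> \<tau>) (\<lambda>A. of_bool (e \<in> A)) = 1 - edge_pass I S \<sigma> \<tau> e"
proof -
  let ?p = "\<lambda>e. bernoulli_pmf (1 - edge_pass I S \<sigma> \<tau> e)"
  have "e \<in> edges I" using assms(4) by (simp add: touching_def)
  note b = edge_pass_bounds[OF assms(1) this assms(2,3), of S]
  have "measure_pmf.expectation (failures I S \<sigma> \<tau>) (\<lambda>A. of_bool (e \<in> A)) =
    measure_pmf.expectation (map_pmf (\<lambda>F. F e) (Pi_pmf (touching I S) False ?p)) (of_bool :: _ \<Rightarrow> real)"
    using assms(4) by (simp add: failures_def)
  also have "\<dots> = measure_pmf.expectation (?p e) of_bool"
    using assms(4) by (simp add: Pi_pmf_component[OF finite_touching[OF assms(1)]])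
  also have "\<dots> = 1 - edge_pass I S \<sigma> \<tau> e"
    using b by simp
  finally show ?thesis .
qed

lemma card_Union_edges_le:
  assumes "ising_model I" "A \<subseteq> touching I S"
  shows "real (card (\<Union>A)) \<le> (\<Sum>e\<in>touching I S. 2 * of_bool (e \<in> A))"
proof -
  have "card (\<Union>A) \<le> (\<Sum>e\<in>A. card e)"
    by (rule card_Union_le_sum_card)
  also have "\<dots> = (\<Sum>e\<in>A. 2)"
    by (rule sum.cong) (use assms in \<open>auto simp: ising_model_def touching_def\<close>)
  also have "\<dots> = (\<Sum>e\<in>touching I S. if e \<in> A then 2 else 0)"
    using assms(2) by (simp add: sum.inter_restrict[symmetric] finite_touching[OF assms(1)] Int_absorb1)
  finally have "real (card (\<Union>A)) \<le> real \<dots>" by (simp only: of_nat_le_iff)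
  also have "\<dots> = (\<Sum>e\<in>touching I S. 2 * of_bool (e \<in> A))"
    unfolding of_nat_sum by (rule sum.cong) auto
  finally show ?thesis .
qed

text \<open>Union bound: each failed edge activates at most two vertices, and linearity of
  expectation reduces the rest to single edges.\<close>

lemma expectation_step_le:
  assumes I: "ising_model I" and S: "S \<subseteq> verts I" and \<sigma>: "\<sigma> \<in> configs I"
  shows "active_mean (step I (\<sigma>, S)) \<le> (\<Sum>e\<in>touching I S. 2 * (1 - mean_pass I S \<sigma> e))"
proof -
  let ?T = "touching I S" and ?R = "resample S \<sigma>"
  let ?E = "\<lambda>\<tau>. measure_pmf.expectation (map_pmf (\<lambda>A. (\<tau>, \<Union>A)) (failures I S \<sigma> \<tau>)) (\<lambda>x. real (card (snd x)))"
  have "active_mean (step I (\<sigma>, S)) = (\<Sum>\<tau>\<in>set_pmf ?R. pmf ?R \<tau> *\<^sub>R ?E \<tau>)"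
    unfolding active_mean_def step_def split
    by (rule pmf_expectation_bind) (auto simp: finite_set_resample[OF I S \<sigma>] finite_set_failures[OF I])
  also have "\<dots> \<le> (\<Sum>\<tau>\<in>set_pmf ?R. pmf ?R \<tau> *\<^sub>R (\<Sum>e\<in>?T. 2 * (1 - edge_pass I S \<sigma> \<tau> e)))"
  proof (intro sum_mono scaleR_left_mono)
    fix \<tau> assume "\<tau> \<in> set_pmf ?R"
    hence \<tau>: "\<tau> \<in> configs I" by (rule resample_in_configs[OF I S \<sigma>])
    have int: "integrable (failures I S \<sigma> \<tau>) g" for g :: "_ \<Rightarrow> real"
      by (rule integrable_measure_pmf_finite[OF finite_set_failures[OF I]])
    have "?E \<tau> = measure_pmf.expectation (failures I S \<sigma> \<tau>) (\<lambda>A. real (card (\<Union>A)))"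
      by simp
    also have "\<dots> \<le> measure_pmf.expectation (failures I S \<sigma> \<tau>) (\<lambda>A. \<Sum>e\<in>?T. 2 * of_bool (e \<in> A))"
      by (rule integral_mono_AE[OF int int], rule AE_pmfI, rule card_Union_edges_le[OF I])
        (use set_failures in blast)
    also have "\<dots> = (\<Sum>e\<in>?T. 2 * (1 - edge_pass I S \<sigma> \<tau> e))"
      by (subst Bochner_Integration.integral_sum[OF int])
        (simp add: prob_in_failures[OF I \<sigma> \<tau>])
    finally show "?E \<tau> \<le> (\<Sum>e\<in>?T. 2 * (1 - edge_pass I S \<sigma> \<tau> e))" .
  qed simp
  also have "\<dots> = measure_pmf.expectation ?R (\<lambda>\<tau>. \<Sum>e\<in>?T. 2 * (1 - edge_pass I S \<sigma> \<tau> e))"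
    by (rule integral_measure_pmf[symmetric]) (auto simp: finite_set_resample[OF I S \<sigma>])
  also have "\<dots> = (\<Sum>e\<in>?T. 2 * (1 - measure_pmf.expectation ?R (\<lambda>\<tau>. edge_pass I S \<sigma> \<tau> e)))"
    by (simp add: integrable_measure_pmf_finite[OF finite_set_resample[OF I S \<sigma>]])
  also have "\<dots> = (\<Sum>e\<in>?T. 2 * (1 - mean_pass I S \<sigma> e))"
    by (simp add: expectation_edge_pass[OF I S \<sigma>])
  finally show ?thesis .
qed

section \<open>Spin bias and contraction in the subcritical regime\<close>

locale subcritical_ising =
  fixes I :: ising and \<alpha> :: real
  assumes model: "ising_model I"
    and alpha: "\<alpha> = 1 + 2 / (1 + exp (- 1 / \<alpha>))"
    and coupling: "\<And>e. e \<in> edges I \<Longrightarrow>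
      exp (- 2 * \<bar>beta I e\<bar>) \<ge> 1 - 1 / (\<alpha> * real (max_degree I) + 1)"
begin

text \<open>The fixed-point equation alone gives this, without a numerical value of the
  root.\<close>

lemma alpha_gt_1: "\<alpha> > 1"
proof -
  have "2 / (1 + exp (- 1 / \<alpha>)) > 0"
    by (intro divide_pos_pos add_pos_pos) auto
  thus ?thesis using alpha by linarith
qed

lemma card_incident_le: "v \<in> verts I \<Longrightarrow> card (incident I v) \<le> max_degree I"
  using model by (auto simp: max_degree_def ising_model_def intro!: Max_ge)

lemma card_touching_le:
  assumes "S \<subseteq> verts I"
  shows "card (touching I S) \<le> card S * max_degree I"
proof -
  have "finite S"
    using assms model finite_subset by (auto simp: ising_model_def)
  have "touching I S = (\<Union>v\<in>S. incident I v)"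
    by (auto simp: touching_def incident_def)
  also have "card \<dots> \<le> (\<Sum>v\<in>S. card (incident I v))"
    by (rule card_UN_le[OF \<open>finite S\<close>])
  also have "\<dots> \<le> (\<Sum>v\<in>S. max_degree I)"
    by (rule sum_mono) (use assms card_incident_le in auto)
  finally show ?thesis by simp
qed

text \<open>With \<open>x = 1 / (\<alpha> * d)\<close> for the degree \<open>d > 0\<close>, the base
  equals \<open>1 / (1 + x)\<close>, which is at least \<open>exp (- x)\<close>. The
  \<open>d\<close>-th power of the latter is free of \<open>d\<close>.\<close>

lemma exp_le_power:
  "exp (- 1 / \<alpha>) \<le> (1 - 1 / (\<alpha> * real (max_degree I) + 1)) ^ max_degree I"
proof (cases "max_degree I = 0")
  case True
  thus ?thesis using alpha_gt_1 by simp
next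
  case False
  define d where "d = real (max_degree I)"
  have d: "d > 0" using False by (simp add: d_def)
  have a: "\<alpha> * d > 0" using d alpha_gt_1 by simp
  have "1 + 1 / (\<alpha> * d) \<le> exp (1 / (\<alpha> * d))" by (rule exp_ge_add_one_self)
  hence "exp (- (1 / (\<alpha> * d))) \<le> 1 / (1 + 1 / (\<alpha> * d))"
    using a by (simp add: exp_minus divide_simps add_pos_pos)
  also have "\<dots> = 1 - 1 / (\<alpha> * d + 1)"
    using a by (simp add: divide_simps add_pos_pos) auto
  finally have "exp (- (1 / (\<alpha> * d))) ^ max_degree I \<le> (1 - 1 / (\<alpha> * d + 1)) ^ max_degree I"
    by (rule power_mono) simp
  moreover have "exp (- (1 / (\<alpha> * d))) ^ max_degree I = exp (- 1 / \<alpha>)"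
    using d by (simp add: exp_of_nat_mult[symmetric] d_def)
  ultimately show ?thesis by (simp add: d_def)
qed

text \<open>Only the edges at \<open>v\<close> change their factor. Each factor is at most 1 before
  the flip and at least \<open>?q\<close> after it; there are at most \<open>max_degree I\<close> of
  them, so \<open>exp_le_power\<close> applies.\<close>

lemma weight_flip_ge:
  assumes v: "v \<in> verts I" and \<sigma>: "\<sigma> \<in> configs I"
  shows "exp (- 1 / \<alpha>) * weight I \<sigma> \<le> weight I (flip v \<sigma>)"
proof -
  let ?\<phi> = "\<lambda>\<sigma> e. edge_factor (beta I e) (\<Prod>v\<in>e. \<sigma> v)" and ?N = "incident I v"
  let ?q = "1 - 1 / (\<alpha> * real (max_degree I) + 1)"
  have fin: "finite (edges I)" "finite ?N" "?N \<subseteq> edges I"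
    using finite_edges[OF model] by (auto simp: incident_def)
  have "\<alpha> * real (max_degree I) \<ge> 0"
    using alpha_gt_1 by simp
  hence q: "0 \<le> ?q" "?q \<le> 1"
    by (auto simp: divide_le_eq)
  have split: "prod (?\<phi> \<sigma>) (edges I) = prod (?\<phi> \<sigma>) (edges I - ?N) * prod (?\<phi> \<sigma>) ?N" for \<sigma>
    by (rule prod.subset_diff[OF fin(3,1)])
  have "exp (- 1 / \<alpha>) * prod (?\<phi> \<sigma>) ?N \<le> ?q ^ card ?N * 1"
  proof (rule mult_mono)
    show "exp (- 1 / \<alpha>) \<le> ?q ^ card ?N"
      using exp_le_power power_decreasing[OF card_incident_le[OF v] q] by linarith
    show "prod (?\<phi> \<sigma>) ?N \<le> 1"
      by (rule prod_le_1) (use edge_factor_bounds(1)[OF spin_prod_cases[OF model _ \<sigma>]] fin in auto)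
  qed (use q in \<open>auto intro!: prod_nonneg\<close>)
  also have "\<dots> = (\<Prod>e\<in>?N. ?q)" by simp
  also have "\<dots> \<le> prod (?\<phi> (flip v \<sigma>)) ?N"
  proof (rule prod_mono)
    fix e assume "e \<in> ?N"
    hence e: "e \<in> edges I" by (simp add: incident_def)
    have "flip v \<sigma> \<in> configs I" using v \<sigma> by simp
    from edge_factor_bounds(2)[OF spin_prod_cases[OF model e this], of "beta I e"] coupling[OF e] q
    show "0 \<le> ?q \<and> ?q \<le> ?\<phi> (flip v \<sigma>) e" by linarith
  qed
  finally have 1: "exp (- 1 / \<alpha>) * prod (?\<phi> \<sigma>) ?N \<le> prod (?\<phi> (flip v \<sigma>)) ?N" .
  have 2: "prod (?\<phi> (flip v \<sigma>)) (edges I - ?N) = prod (?\<phi> \<sigma>) (edges I - ?N)"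
  proof (rule prod.cong[OF refl])
    fix e assume e: "e \<in> edges I - ?N"
    hence "finite e" "v \<notin> e"
      using model finite_subset by (auto simp: ising_model_def incident_def)
    thus "?\<phi> (flip v \<sigma>) e = ?\<phi> \<sigma> e" by (simp add: prod_flip)
  qed
  have "exp (- 1 / \<alpha>) * prod (?\<phi> \<sigma>) (edges I) \<le> prod (?\<phi> (flip v \<sigma>)) (edges I)"
    unfolding split 2 using mult_left_mono[OF 1, of "prod (?\<phi> \<sigma>) (edges I - ?N)"]
    by (simp add: mult.left_commute prod_nonneg)
  hence "(\<Prod>e\<in>edges I. exp \<bar>beta I e\<bar>) * (exp (- 1 / \<alpha>) * prod (?\<phi> \<sigma>) (edges I))
    \<le> (\<Prod>e\<in>edges I. exp \<bar>beta I e\<bar>) * prod (?\<phi> (flip v \<sigma>)) (edges I)"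
    by (intro mult_left_mono prod_nonneg) auto
  thus ?thesis
    unfolding weight_edge_factor by (simp only: mult.left_commute)
qed

text \<open>Hence, given the other spins and the active set, neither value of an inactive spin has
  conditional probability above \<open>1 / (1 + exp (- 1 / \<alpha>))\<close>.\<close>

lemma pmf_flip_ge:
  assumes "conditionally_gibbs I \<mu>" "v \<in> verts I" "v \<notin> S" "\<sigma> \<in> configs I"
  shows "exp (- 1 / \<alpha>) * pmf \<mu> (\<sigma>, S) \<le> pmf \<mu> (flip v \<sigma>, S)"
proof -
  have "exp (- 1 / \<alpha>) * pmf \<mu> (\<sigma>, S) * weight I \<sigma> = pmf \<mu> (\<sigma>, S) * (exp (- 1 / \<alpha>) * weight I \<sigma>)"
    by simp
  also have "\<dots> \<le> pmf \<mu> (\<sigma>, S) * weight I (flip v \<sigma>)"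
    by (intro mult_left_mono weight_flip_ge assms) simp
  also have "\<dots> = pmf \<mu> (flip v \<sigma>, S) * weight I \<sigma>"
    using assms by (auto simp: conditionally_gibbs_def)
  finally show ?thesis
    using weight_pos[of I \<sigma>] by simp
qed

text \<open>In the application \<open>a\<close> is the mass where the old spin product is favoured,
  \<open>b\<close> the mass after the flip, and \<open>m\<close> the smaller edge factor. The left
  side is \<open>(1 - m) / 2 * (a * (2 + m) + b)\<close>, at most
  \<open>(1 - m) / 2 * (3 * a + b)\<close>, and the equation for \<open>\<alpha>\<close> turns the
  bias bound into \<open>3 * a + b \<le> \<alpha> * (a + b)\<close>.\<close>

lemma fail_pair_le:
  assumes "exp (- 1 / \<alpha>) * a \<le> b" "0 \<le> a" "0 \<le> b" "0 \<le> m" "m \<le> 1"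
  shows "a * (1 - m * ((1 + m) / 2)) + b * (1 - (1 + m) / 2) \<le> \<alpha> * (1 - m) / 2 * (a + b)"
proof -
  define h where "h = exp (- 1 / \<alpha>)"
  have h: "h > 0" by (simp add: h_def)
  have "2 * a \<le> 2 / (1 + h) * (a + b)"
    using assms(1)[folded h_def] h by (simp add: field_simps)
  moreover have "\<alpha> * (a + b) = a + b + 2 / (1 + h) * (a + b)"
    using alpha unfolding h_def by (metis distrib_right mult_1)
  moreover have "a * m \<le> a" using assms by (simp add: mult_left_le)
  ultimately have "a * (2 + m) + b \<le> \<alpha> * (a + b)" by (simp add: algebra_simps)
  hence "(1 - m) / 2 * (a * (2 + m) + b) \<le> (1 - m) / 2 * (\<alpha> * (a + b))"
    by (rule mult_left_mono) (use assms in simp)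
  thus ?thesis by (simp add: field_simps)
qed

text \<open>An edge inside \<open>S\<close> fails with mean probability \<open>(1 - m) / 2\<close>,
  which suffices as \<open>\<alpha> > 1\<close>. Otherwise configurations are paired by flipping an
  inactive endpoint of \<open>e\<close>, and \<open>fail_pair_le\<close> bounds each pair.\<close>

lemma mean_failure_le:
  assumes cg: "conditionally_gibbs I \<mu>" and S: "S \<subseteq> verts I" and e: "e \<in> touching I S"
  shows "(\<Sum>\<sigma>\<in>configs I. pmf \<mu> (\<sigma>, S) * (1 - mean_pass I S \<sigma> e)) \<le>
    \<alpha> * (1 - exp (- 2 * \<bar>beta I e\<bar>)) / 2 * (\<Sum>\<sigma>\<in>configs I. pmf \<mu> (\<sigma>, S))"
proof -
  define m where "m = exp (- 2 * \<bar>beta I e\<bar>)"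
  have m: "0 < m" "m \<le> 1" by (simp_all add: m_def)
  have e': "e \<in> edges I" "e \<subseteq> verts I" "finite e"
    using e model finite_subset by (auto simp: touching_def ising_model_def)
  show ?thesis
  proof (cases "e \<subseteq> S")
    case True
    have "1 - (1 + m) / 2 \<le> \<alpha> * (1 - m) / 2"
      using mult_right_mono[of 1 \<alpha> "1 - m"] alpha_gt_1 m by (simp add: field_simps)
    moreover have "mean_pass I S \<sigma> e = (1 + m) / 2" for \<sigma>
      using True by (simp add: mean_pass_def m_def)
    ultimately have "(\<Sum>\<sigma>\<in>configs I. pmf \<mu> (\<sigma>, S) * (1 - mean_pass I S \<sigma> e)) \<le>
        (\<Sum>\<sigma>\<in>configs I. pmf \<mu> (\<sigma>, S) * (\<alpha> * (1 - m) / 2))"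
      by (intro sum_mono mult_left_mono) (simp_all only: pmf_nonneg)
    thus ?thesis
      unfolding m_def sum_distrib_right[symmetric] by (simp only: mult.commute)
  next
    case False
    then obtain v where v: "v \<in> e" "v \<notin> S" by auto
    hence vV: "v \<in> verts I" using e' by auto
    let ?f = "\<lambda>\<sigma>. pmf \<mu> (\<sigma>, S) * (1 - mean_pass I S \<sigma> e)"
    have pair: "?f \<sigma> + ?f (flip v \<sigma>) \<le>
      \<alpha> * (1 - m) / 2 * (pmf \<mu> (\<sigma>, S) + pmf \<mu> (flip v \<sigma>, S))" if \<sigma>: "\<sigma> \<in> configs I" for \<sigma>
    proof -
      let ?a = "pmf \<mu> (\<sigma>, S)" and ?b = "pmf \<mu> (flip v \<sigma>, S)"
      have 1: "exp (- 1 / \<alpha>) * ?a \<le> ?b" 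
        by (rule pmf_flip_ge[OF cg vV v(2) \<sigma>])
      have 2: "exp (- 1 / \<alpha>) * ?b \<le> ?a"
        using pmf_flip_ge[OF cg vV v(2), of "flip v \<sigma>"] \<sigma> vV by simp
      from spin_prod_cases[OF model e'(1) \<sigma>] show ?thesis
      proof (rule edge_factor_cases[of _ "beta I e"])
        assume "edge_factor (beta I e) (\<Prod>u\<in>e. \<sigma> u) = 1"
          "edge_factor (beta I e) (- (\<Prod>u\<in>e. \<sigma> u)) = exp (- 2 * \<bar>beta I e\<bar>)"
        thus ?thesis
          using fail_pair_le[OF 1, of m] m v False
          by (simp add: mean_pass_def prod_flip[OF e'(3)] m_def)
      next
        assume "edge_factor (beta I e) (\<Prod>u\<in>e. \<sigma> u) = exp (- 2 * \<bar>beta I e\<bar>)"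
          "edge_factor (beta I e) (- (\<Prod>u\<in>e. \<sigma> u)) = 1"
        thus ?thesis
          using fail_pair_le[OF 2, of m] m v False
          by (simp add: mean_pass_def prod_flip[OF e'(3)] add.commute m_def)
      qed
    qed
    have re: "(\<Sum>\<sigma>\<in>configs I. g (flip v \<sigma>)) = (\<Sum>\<sigma>\<in>configs I. g \<sigma>)" for g :: "_ \<Rightarrow> real"
      by (rule sum.reindex_bij_betw[OF bij_betw_flip[OF vV]])
    \<comment> \<open>The flip permutes the configurations, so summing over pairs counts each of
      them twice.\<close>
    have "2 * (\<Sum>\<sigma>\<in>configs I. ?f \<sigma>) = (\<Sum>\<sigma>\<in>configs I. ?f \<sigma> + ?f (flip v \<sigma>))"
      using re[of ?f] by (simp add: sum.distrib)
    also have "\<dots> \<le> (\<Sum>\<sigma>\<in>configs I. \<alpha> * (1 - m) / 2 * (pmf \<mu> (\<sigma>, S) + pmf \<mu> (flip v \<sigma>, S)))"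
      by (rule sum_mono[OF pair])
    also have "\<dots> = 2 * (\<alpha> * (1 - m) / 2 * (\<Sum>\<sigma>\<in>configs I. pmf \<mu> (\<sigma>, S)))"
      unfolding sum_distrib_left[symmetric] sum.distrib re[of "\<lambda>\<sigma>. pmf \<mu> (\<sigma>, S)"] by simp
    finally show ?thesis by (simp add: m_def)
  qed
qed

lemma active_mean_sum:
  assumes "conditionally_gibbs I \<mu>"
  shows "active_mean \<mu> = (\<Sum>S\<in>Pow (verts I). real (card S) * (\<Sum>\<sigma>\<in>configs I. pmf \<mu> (\<sigma>, S)))"
proof -
  have "active_mean \<mu> = (\<Sum>x\<in>configs I \<times> Pow (verts I). real (card (snd x)) * pmf \<mu> x)"
    unfolding active_mean_def
    by (rule integral_measure_pmf_real[OF finite_states[OF model]])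
      (use assms in \<open>auto simp: conditionally_gibbs_def\<close>)
  also have "\<dots> = (\<Sum>\<sigma>\<in>configs I. \<Sum>S\<in>Pow (verts I). real (card S) * pmf \<mu> (\<sigma>, S))"
    by (simp add: sum.cartesian_product case_prod_unfold)
  also have "\<dots> = (\<Sum>S\<in>Pow (verts I). \<Sum>\<sigma>\<in>configs I. real (card S) * pmf \<mu> (\<sigma>, S))"
    by (rule sum.swap)
  finally show ?thesis by (simp add: sum_distrib_left)
qed

text \<open>A set \<open>S\<close> touches at most \<open>card S * max_degree I\<close> edges.
  Averaged over the spins, each fails with probability at most \<open>\<alpha> / 2\<close> times
  \<open>1 / (\<alpha> * ?d + 1)\<close> and then activates at most two vertices; the product is the
  contraction factor.\<close>

lemma active_mean_bind_step:
  assumes cg: "conditionally_gibbs I \<mu>"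
  shows "active_mean (bind_pmf \<mu> (step I)) \<le>
    \<alpha> * real (max_degree I) / (\<alpha> * real (max_degree I) + 1) * active_mean \<mu>"
proof -
  let ?\<Omega> = "configs I \<times> Pow (verts I)" and ?d = "real (max_degree I)"
  have supp: "set_pmf \<mu> \<subseteq> ?\<Omega>" using cg by (simp add: conditionally_gibbs_def)
  have pos: "\<alpha> * ?d + 1 > 0" using alpha_gt_1 by (simp add: add_nonneg_pos)
  have "active_mean (bind_pmf \<mu> (step I)) = (\<Sum>x\<in>?\<Omega>. pmf \<mu> x *\<^sub>R active_mean (step I x))"
    unfolding active_mean_def
  proof (rule pmf_expectation_bind[OF finite_states[OF model] _ supp])
    fix x assume "x \<in> ?\<Omega>"
    thus "finite (set_pmf (step I x))"
      using set_step[OF model] finite_states[OF model] by (cases x) (auto intro: finite_subset)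
  qed
  also have "\<dots> = (\<Sum>\<sigma>\<in>configs I. \<Sum>S\<in>Pow (verts I). pmf \<mu> (\<sigma>, S) * active_mean (step I (\<sigma>, S)))"
    by (simp add: sum.cartesian_product case_prod_unfold)
  also have "\<dots> = (\<Sum>S\<in>Pow (verts I). \<Sum>\<sigma>\<in>configs I. pmf \<mu> (\<sigma>, S) * active_mean (step I (\<sigma>, S)))"
    by (rule sum.swap)
  also have "\<dots> \<le> (\<Sum>S\<in>Pow (verts I). \<alpha> * ?d / (\<alpha> * ?d + 1) *
      (real (card S) * (\<Sum>\<sigma>\<in>configs I. pmf \<mu> (\<sigma>, S))))"
  proof (rule sum_mono)
    fix S assume "S \<in> Pow (verts I)"
    hence S: "S \<subseteq> verts I" by simp
    let ?M = "\<Sum>\<sigma>\<in>configs I. pmf \<mu> (\<sigma>, S)"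
    have M: "?M \<ge> 0" by (rule sum_nonneg) simp
    have "(\<Sum>\<sigma>\<in>configs I. pmf \<mu> (\<sigma>, S) * active_mean (step I (\<sigma>, S)))
      \<le> (\<Sum>\<sigma>\<in>configs I. pmf \<mu> (\<sigma>, S) * (\<Sum>e\<in>touching I S. 2 * (1 - mean_pass I S \<sigma> e)))"
      by (intro sum_mono mult_left_mono expectation_step_le[OF model S]) auto
    also have "\<dots> = (\<Sum>e\<in>touching I S. 2 * (\<Sum>\<sigma>\<in>configs I. pmf \<mu> (\<sigma>, S) * (1 - mean_pass I S \<sigma> e)))"
      unfolding sum_distrib_left by (subst sum.swap) (simp only: mult.left_commute)
    also have "\<dots> \<le> (\<Sum>e\<in>touching I S. \<alpha> / (\<alpha> * ?d + 1) * ?M)"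
    proof (rule sum_mono)
      fix e assume e: "e \<in> touching I S"
      hence "1 - exp (- 2 * \<bar>beta I e\<bar>) \<le> 1 / (\<alpha> * ?d + 1)"
        using coupling[of e] by (simp add: touching_def)
      hence "\<alpha> * (1 - exp (- 2 * \<bar>beta I e\<bar>)) * ?M \<le> \<alpha> * (1 / (\<alpha> * ?d + 1)) * ?M"
        using alpha_gt_1 M by (intro mult_right_mono mult_left_mono) auto
      with mean_failure_le[OF cg S e]
      show "2 * (\<Sum>\<sigma>\<in>configs I. pmf \<mu> (\<sigma>, S) * (1 - mean_pass I S \<sigma> e)) \<le> \<alpha> / (\<alpha> * ?d + 1) * ?M"
        by simp
    qed
    also have "\<dots> = real (card (touching I S)) * (\<alpha> / (\<alpha> * ?d + 1) * ?M)" by simp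
    also have "\<dots> \<le> real (card S * max_degree I) * (\<alpha> / (\<alpha> * ?d + 1) * ?M)"
      using card_touching_le[OF S] alpha_gt_1 M pos
      by (intro mult_right_mono) (simp_all only: of_nat_le_iff, simp)
    finally show "(\<Sum>\<sigma>\<in>configs I. pmf \<mu> (\<sigma>, S) * active_mean (step I (\<sigma>, S))) \<le>
        \<alpha> * ?d / (\<alpha> * ?d + 1) * (real (card S) * ?M)"
      by (simp add: mult_ac)
  qed
  also have "\<dots> = \<alpha> * ?d / (\<alpha> * ?d + 1) * active_mean \<mu>"
    unfolding active_mean_sum[OF cg] sum_distrib_left ..
  finally show ?thesis .
qed

end

section \<open>Rounds, cost and output of the chain\<close>

lemma nn_integral_measure_spmf_bind_pmf:
  "(\<integral>\<^sup>+ y. f y \<partial>measure_spmf (bind_pmf p q)) = (\<integral>\<^sup>+ x. \<integral>\<^sup>+ y. f y \<partial>measure_spmf (q x) \<partial>measure_pmf p)"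
  unfolding measure_spmf_bind_pmf
  by (subst nn_integral_bind[where B = "count_space UNIV"])
    (auto simp: space_subprob_algebra)

text \<open>Single flips connect every configuration to the all-plus one; the induction is on the
  number of minus spins.\<close>

lemma flip_invariant_constant:
  fixes f :: "(nat \<Rightarrow> int) \<Rightarrow> 'a"
  assumes I: "ising_model I"
    and inv: "\<And>v \<sigma>. v \<in> verts I \<Longrightarrow> \<sigma> \<in> configs I \<Longrightarrow> f (flip v \<sigma>) = f \<sigma>"
    and \<sigma>: "\<sigma> \<in> configs I"
  shows "f \<sigma> = f (\<lambda>v\<in>verts I. 1)"
proof -
  have fin: "finite (verts I)" using I by (simp add: ising_model_def)
  show ?thesis
    using \<sigma>
  proof (induction "card {v \<in> verts I. \<sigma> v \<noteq> 1}" arbitrary: \<sigma>)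
    case 0
    hence "\<forall>v\<in>verts I. \<sigma> v = 1" using fin by auto
    hence "\<sigma> = (\<lambda>v\<in>verts I. 1)"
      using 0 by (auto simp: configs_def PiE_def extensional_def)
    thus ?case by simp
  next
    case (Suc n)
    then obtain v where v: "v \<in> verts I" "\<sigma> v \<noteq> 1"
      by (metis (mono_tags, lifting) Collect_empty_eq card.empty nat.distinct(1))
    have "\<sigma> v = -1" using v Suc.prems by (auto simp: configs_def PiE_def Pi_def)
    hence "{u \<in> verts I. flip v \<sigma> u \<noteq> 1} = {u \<in> verts I. \<sigma> u \<noteq> 1} - {v}"
      by (auto simp: flip_def)
    hence "n = card {u \<in> verts I. flip v \<sigma> u \<noteq> 1}"
      using Suc.hyps(2) v fin by simp
    from Suc.hyps(1)[OF this] v Suc.prems have "f (flip v \<sigma>) = f (\<lambda>v\<in>verts I. 1)" by simp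
    thus ?case using inv[OF v(1) Suc.prems] by simp
  qed
qed

lemma step_empty: "step I (\<sigma>, {}) = return_pmf (\<sigma>, {})"
  by (simp add: step_def resample_def failures_def touching_def bind_return_pmf)

lemma nn_integral_active:
  assumes "ising_model I" "conditionally_gibbs I \<mu>"
  shows "(\<integral>\<^sup>+ x. of_nat (card (snd x)) \<partial>\<mu>) = ennreal (active_mean \<mu>)"
proof -
  have "finite (set_pmf \<mu>)"
    using assms finite_states[OF assms(1)] by (auto simp: conditionally_gibbs_def intro: finite_subset)
  thus ?thesis
    unfolding active_mean_def ennreal_of_nat_eq_real_of_nat
    by (intro nn_integral_eq_integral integrable_measure_pmf_finite) auto
qed

lemma conditionally_gibbs_active:
  "conditionally_gibbs I \<mu> \<Longrightarrow> x \<in> set_pmf \<mu> \<Longrightarrow> snd x \<subseteq> verts I"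
  by (cases x) (auto simp: conditionally_gibbs_def)

text \<open>The truncation \<open>r \<le> t\<close> lets the fixed-point equation of \<open>run\<close> give upper bounds by induction on
  \<open>t\<close>, without appeal to leastness.\<close>

definition potential :: "ising \<Rightarrow> nat \<Rightarrow> (nat \<Rightarrow> int) \<times> nat set \<Rightarrow> ennreal" where
  "potential I t x =
     (\<integral>\<^sup>+ (\<sigma>, r, n). (if r \<le> t then of_nat (r + n) else 0) \<partial>measure_spmf (chain_run I x))"

definition mean_rounds :: "ising \<Rightarrow> ((nat \<Rightarrow> int) \<times> nat set) pmf \<Rightarrow> ennreal" where
  "mean_rounds I \<mu> = (\<integral>\<^sup>+ (\<sigma>, r, n). of_nat r \<partial>measure_spmf (bind_pmf \<mu> (chain_run I)))"

lemma nn_integral_chain_run: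
  assumes "ising_model I" "S \<subseteq> verts I" "S \<noteq> {}"
  shows "(\<integral>\<^sup>+ y. f y \<partial>measure_spmf (chain_run I (\<sigma>, S))) =
    (\<integral>\<^sup>+ x. \<integral>\<^sup>+ (\<sigma>, r, n). f (\<sigma>, Suc r, round_cost I S + n) \<partial>measure_spmf (chain_run I x) \<partial>step I (\<sigma>, S))"
  using assms(3)
  by (simp add: chain_run_unfold[OF assms(1,2)] nn_integral_measure_spmf_bind_pmf o_def
      case_prod_unfold)

text \<open>Only an inequality: a halted run adds no round, and mass lost to nontermination is not
  counted.\<close>

lemma mean_rounds_le_Suc:
  assumes I: "ising_model I" and cg: "conditionally_gibbs I \<mu>"
  shows "mean_rounds I \<mu> \<le> 1 + mean_rounds I (bind_pmf \<mu> (step I))"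
proof -
  let ?r = "\<lambda>x. \<integral>\<^sup>+ (\<sigma>, r, n). of_nat r \<partial>measure_spmf (chain_run I x)"
  have *: "?r (\<sigma>, S) \<le> 1 + (\<integral>\<^sup>+ y. ?r y \<partial>step I (\<sigma>, S))" if S: "S \<subseteq> verts I" for \<sigma> S
  proof (cases "S = {}")
    case True
    thus ?thesis using chain_run_unfold[OF I, of "{}" \<sigma>] 
      by (simp add: measure_spmf_return_spmf nn_integral_return)
  next
    case False
    have "?r (\<sigma>, S) = (\<integral>\<^sup>+ x. \<integral>\<^sup>+ (\<sigma>, r, n). 1 + of_nat r \<partial>measure_spmf (chain_run I x) \<partial>step I (\<sigma>, S))"
      by (simp add: nn_integral_chain_run[OF I S False] case_prod_unfold)
    also have "\<dots> \<le> (\<integral>\<^sup>+ x. 1 + ?r x \<partial>step I (\<sigma>, S))"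
      by (rule nn_integral_mono)
        (simp add: case_prod_unfold nn_integral_add measure_spmf.subprob_emeasure_le_1 add_right_mono)
    also have "\<dots> = 1 + (\<integral>\<^sup>+ y. ?r y \<partial>step I (\<sigma>, S))"
      by (simp add: nn_integral_add)
    finally show ?thesis .
  qed
  have "mean_rounds I \<mu> = (\<integral>\<^sup>+ x. ?r x \<partial>\<mu>)"
    by (simp add: mean_rounds_def nn_integral_measure_spmf_bind_pmf)
  also have "\<dots> \<le> (\<integral>\<^sup>+ x. 1 + (\<integral>\<^sup>+ y. ?r y \<partial>step I x) \<partial>\<mu>)"
  proof (rule nn_integral_mono_AE, rule AE_pmfI)
    fix x assume "x \<in> set_pmf \<mu>"
    hence "snd x \<subseteq> verts I" by (rule conditionally_gibbs_active[OF cg])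
    from *[OF this, of "fst x"] show "?r x \<le> 1 + (\<integral>\<^sup>+ y. ?r y \<partial>step I x)" by simp
  qed
  also have "\<dots> = 1 + (\<integral>\<^sup>+ x. \<integral>\<^sup>+ y. ?r y \<partial>step I x \<partial>\<mu>)"
    by (simp add: nn_integral_add)
  also have "\<dots> = 1 + mean_rounds I (bind_pmf \<mu> (step I))"
    by (simp add: mean_rounds_def nn_integral_measure_spmf_bind_pmf)
  finally show ?thesis .
qed

context subcritical_ising
begin

section \<open>Expected rounds and cost in the subcritical regime\<close>

abbreviation "\<Delta> \<equiv> real (max_degree I)"

abbreviation "rate \<equiv> \<alpha> * \<Delta> / (\<alpha> * \<Delta> + 1)"

text \<open>Sum of a geometric series: a round costs at most \<open>\<Delta> + 2\<close> per active
  vertex, for the round itself, one spin and \<open>\<Delta>\<close> edges, and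
  \<open>1 / (1 - rate) = \<alpha> * \<Delta> + 1\<close>.\<close>

abbreviation "cost_factor \<equiv> (\<Delta> + 2) * (\<alpha> * \<Delta> + 1)"

lemma rate_bounds: "0 \<le> rate" "rate < 1"
proof -
  have "\<alpha> * \<Delta> \<ge> 0" using alpha_gt_1 by simp
  thus "0 \<le> rate" "rate < 1" by (simp_all add: divide_less_eq)
qed

lemma cost_factor_nonneg: "0 \<le> cost_factor"
  using alpha_gt_1 by simp

lemma active_mean_nonneg: "0 \<le> active_mean \<mu>"
  by (simp add: active_mean_def)

lemma potential_Suc_le:
  assumes S: "S \<subseteq> verts I"
  shows "potential I (Suc t) (\<sigma>, S) \<le>
    ennreal (\<Delta> + 2) * of_nat (card S) + (\<integral>\<^sup>+ x. potential I t x \<partial>step I (\<sigma>, S))"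
proof (cases "S = {}")
  case True
  thus ?thesis using chain_run_unfold[OF model, of "{}" \<sigma>]
    by (simp add: potential_def measure_spmf_return_spmf nn_integral_return)
next
  case False
  let ?c = "of_nat (Suc (round_cost I S)) :: ennreal"
  let ?g = "\<lambda>y :: (nat \<Rightarrow> int) \<times> nat \<times> nat. if fst (snd y) \<le> t then of_nat (fst (snd y) + snd (snd y)) else 0 :: ennreal"
  have "finite S" using S model finite_subset by (auto simp: ising_model_def)
  hence "1 \<le> card S" using False by (simp add: Suc_le_eq card_gt_0_iff)
  \<comment> \<open>The round itself is charged to one active vertex, which exists since
    \<open>S\<close> is nonempty.\<close>
  hence "Suc (round_cost I S) \<le> (max_degree I + 2) * card S"
    using card_touching_le[OF S] by (simp add: round_cost_def algebra_simps)
  hence "?c \<le> of_nat ((max_degree I + 2) * card S)"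
    by (simp only: of_nat_le_iff)
  also have "\<dots> = ennreal (\<Delta> + 2) * of_nat (card S)"
    by (simp add: ennreal_of_nat_eq_real_of_nat ennreal_mult[symmetric] algebra_simps del: ennreal_plus)
  finally have c: "?c \<le> ennreal (\<Delta> + 2) * of_nat (card S)" .
  have "potential I (Suc t) (\<sigma>, S) = (\<integral>\<^sup>+ x. \<integral>\<^sup>+ (\<sigma>, r, n).
      (if r \<le> t then of_nat (Suc r + (round_cost I S + n)) else 0) \<partial>measure_spmf (chain_run I x) \<partial>step I (\<sigma>, S))"
    by (simp add: potential_def nn_integral_chain_run[OF model S False] case_prod_unfold add.assoc cong: if_cong)
  also have "\<dots> \<le> (\<integral>\<^sup>+ x. \<integral>\<^sup>+ y. ?c + ?g y \<partial>measure_spmf (chain_run I x) \<partial>step I (\<sigma>, S))"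
    by (intro nn_integral_mono) (auto simp: add_ac)
  also have "\<dots> \<le> (\<integral>\<^sup>+ x. ?c + potential I t x \<partial>step I (\<sigma>, S))"
  proof (rule nn_integral_mono)
    fix x
    have "(\<integral>\<^sup>+ y. ?c \<partial>measure_spmf (chain_run I x)) \<le> ?c * 1"
      unfolding nn_integral_const by (intro mult_left_mono measure_spmf.subprob_emeasure_le_1) simp
    thus "(\<integral>\<^sup>+ y. ?c + ?g y \<partial>measure_spmf (chain_run I x)) \<le> ?c + potential I t x"
      by (simp add: nn_integral_add potential_def case_prod_unfold add_right_mono)
  qed
  also have "\<dots> = ?c + (\<integral>\<^sup>+ x. potential I t x \<partial>step I (\<sigma>, S))"
    by (simp add: nn_integral_add)
  also have "\<dots> \<le> ennreal (\<Delta> + 2) * of_nat (card S) + (\<integral>\<^sup>+ x. potential I t x \<partial>step I (\<sigma>, S))"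
    by (rule add_right_mono[OF c])
  finally show ?thesis .
qed

lemma mean_potential_le:
  assumes "conditionally_gibbs I \<mu>"
  shows "(\<integral>\<^sup>+ x. potential I t x \<partial>\<mu>) \<le> ennreal (cost_factor * active_mean \<mu>)"
  using assms
proof (induction t arbitrary: \<mu>)
  case 0
  \<comment> \<open>Only runs of zero rounds count here, and these make no draws.\<close>
  have "potential I 0 (\<sigma>, S) = 0" if S: "S \<subseteq> verts I" for \<sigma> S
  proof (cases "S = {}")
    case True
    thus ?thesis using chain_run_unfold[OF model, of "{}" \<sigma>]
      by (simp add: potential_def measure_spmf_return_spmf nn_integral_return)
  next
    case False
    thus ?thesis
      by (simp add: potential_def nn_integral_chain_run[OF model S False] case_prod_unfold)
  qed
  hence "(\<integral>\<^sup>+ x. potential I 0 x \<partial>\<mu>) = (\<integral>\<^sup>+ x. 0 \<partial>\<mu>)"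
    using 0 by (intro nn_integral_cong_AE AE_pmfI) (auto simp: conditionally_gibbs_def)
  thus ?case by simp
next
  case (Suc t)
  have "(\<integral>\<^sup>+ x. potential I (Suc t) x \<partial>\<mu>) \<le>
    (\<integral>\<^sup>+ x. ennreal (\<Delta> + 2) * of_nat (card (snd x)) + (\<integral>\<^sup>+ y. potential I t y \<partial>step I x) \<partial>\<mu>)"
  proof (rule nn_integral_mono_AE, rule AE_pmfI)
    fix x assume "x \<in> set_pmf \<mu>"
    hence "snd x \<subseteq> verts I" by (rule conditionally_gibbs_active[OF Suc.prems])
    from potential_Suc_le[OF this, of t "fst x"]
    show "potential I (Suc t) x \<le> ennreal (\<Delta> + 2) * of_nat (card (snd x)) + (\<integral>\<^sup>+ y. potential I t y \<partial>step I x)"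
      by simp
  qed
  also have "\<dots> = ennreal (\<Delta> + 2) * ennreal (active_mean \<mu>) +
      (\<integral>\<^sup>+ x. potential I t x \<partial>bind_pmf \<mu> (step I))"
    by (simp add: nn_integral_add nn_integral_cmult nn_integral_active[OF model Suc.prems])
  also have "\<dots> \<le> ennreal (\<Delta> + 2) * ennreal (active_mean \<mu>) +
      ennreal (cost_factor * active_mean (bind_pmf \<mu> (step I)))"
    by (intro add_left_mono Suc.IH conditionally_gibbs_step[OF model] Suc.prems)
  also have "\<dots> \<le> ennreal (\<Delta> + 2) * ennreal (active_mean \<mu>) +
      ennreal (cost_factor * (rate * active_mean \<mu>))"
    by (intro add_left_mono ennreal_leI mult_left_mono active_mean_bind_step Suc.prems cost_factor_nonneg)
  also have "\<dots> = ennreal ((\<Delta> + 2) * active_mean \<mu> + cost_factor * (rate * active_mean \<mu>))"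
    using active_mean_nonneg[of \<mu>] alpha_gt_1
    by (subst ennreal_mult[symmetric], simp, simp, subst ennreal_plus)
      (auto intro!: mult_nonneg_nonneg)
  \<comment> \<open>\<open>cost_factor\<close> solves \<open>c = (\<Delta> + 2) + c * rate\<close>,
    which closes the induction.\<close>
  also have "(\<Delta> + 2) * active_mean \<mu> + cost_factor * (rate * active_mean \<mu>) = cost_factor * active_mean \<mu>"
  proof -
    have "\<alpha> * \<Delta> + 1 > 0" using alpha_gt_1 by (simp add: add_nonneg_pos)
    hence "(\<alpha> * \<Delta> + 1) * rate = \<alpha> * \<Delta>" by simp
    hence "cost_factor * (rate * active_mean \<mu>) = (\<Delta> + 2) * (\<alpha> * \<Delta>) * active_mean \<mu>"
      by (metis (no_types, opaque_lifting) mult.assoc)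
    thus ?thesis by (simp add: algebra_simps)
  qed
  finally show ?case .
qed

text \<open>Monotone convergence removes the truncation, since the bound in
  \<open>mean_potential_le\<close> does not depend on \<open>t\<close>.\<close>

lemma mean_total_le:
  assumes "conditionally_gibbs I \<mu>"
  shows "(\<integral>\<^sup>+ (\<sigma>, r, n). of_nat (r + n) \<partial>measure_spmf (bind_pmf \<mu> (chain_run I)))
    \<le> ennreal (cost_factor * active_mean \<mu>)"
proof -
  let ?M = "measure_spmf (bind_pmf \<mu> (chain_run I))"
  let ?f = "\<lambda>t (\<sigma> :: nat \<Rightarrow> int, r :: nat, n :: nat). (if r \<le> t then of_nat (r + n) else 0) :: ennreal"
  have "(\<lambda>(\<sigma>, r, n). of_nat (r + n)) = (\<lambda>y. SUP t. ?f t y)"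
  proof
    fix y :: "(nat \<Rightarrow> int) \<times> nat \<times> nat"
    obtain \<sigma> r n where y: "y = (\<sigma>, r, n)" by (metis prod.exhaust)
    show "(case y of (\<sigma>, r, n) \<Rightarrow> of_nat (r + n)) = (SUP t. ?f t y)"
      unfolding y split
      by (intro antisym SUP_least, rule SUP_upper2[of r]) simp_all
  qed
  hence "(\<integral>\<^sup>+ (\<sigma>, r, n). of_nat (r + n) \<partial>?M) = (\<integral>\<^sup>+ y. (SUP t. ?f t y) \<partial>?M)"
    by simp
  also have "\<dots> = (SUP t. \<integral>\<^sup>+ y. ?f t y \<partial>?M)"
    by (rule nn_integral_monotone_convergence_SUP) (auto simp: incseq_def le_fun_def)
  also have "\<dots> \<le> ennreal (cost_factor * active_mean \<mu>)"
    using mean_potential_le[OF assms]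
    by (intro SUP_least) (simp add: nn_integral_measure_spmf_bind_pmf potential_def)
  finally show ?thesis .
qed

section \<open>Iterates of the chain and the number of rounds\<close>

definition chain :: "((nat \<Rightarrow> int) \<times> nat set) pmf \<Rightarrow> nat \<Rightarrow> ((nat \<Rightarrow> int) \<times> nat set) pmf" where
  "chain \<mu> t = ((\<lambda>\<nu>. bind_pmf \<nu> (step I)) ^^ t) \<mu>"

lemma chain_0 [simp]: "chain \<mu> 0 = \<mu>"
  by (simp add: chain_def)

lemma chain_Suc [simp]: "chain \<mu> (Suc t) = bind_pmf (chain \<mu> t) (step I)"
  by (simp add: chain_def)

lemma conditionally_gibbs_chain:
  "conditionally_gibbs I \<mu> \<Longrightarrow> conditionally_gibbs I (chain \<mu> t)"
  by (induction t) (auto intro: conditionally_gibbs_step[OF model])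

lemma active_mean_chain:
  assumes "conditionally_gibbs I \<mu>"
  shows "active_mean (chain \<mu> t) \<le> rate ^ t * active_mean \<mu>"
proof (induction t)
  case (Suc t)
  have "active_mean (chain \<mu> (Suc t)) \<le> rate * active_mean (chain \<mu> t)"
    using active_mean_bind_step[OF conditionally_gibbs_chain[OF assms]] by simp
  also have "\<dots> \<le> rate * (rate ^ t * active_mean \<mu>)"
    by (rule mult_left_mono[OF Suc rate_bounds(1)])
  finally show ?case by simp
qed simp

lemma mean_rounds_le_chain:
  assumes "conditionally_gibbs I \<mu>"
  shows "mean_rounds I \<mu> \<le> of_nat t + mean_rounds I (chain \<mu> t)"
proof (induction t)
  case (Suc t)
  have "mean_rounds I (chain \<mu> t) \<le> 1 + mean_rounds I (chain \<mu> (Suc t))"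
    using mean_rounds_le_Suc[OF model conditionally_gibbs_chain[OF assms]] by simp
  hence "of_nat t + mean_rounds I (chain \<mu> t) \<le> of_nat t + (1 + mean_rounds I (chain \<mu> (Suc t)))"
    by (rule add_left_mono)
  with Suc have "mean_rounds I \<mu> \<le> of_nat t + (1 + mean_rounds I (chain \<mu> (Suc t)))"
    by (rule order_trans)
  thus ?case by (simp add: add_ac)
qed simp

text \<open>The first \<open>t\<close> steps are charged one round each. Later rounds are bounded
  through the total cost, whose bound has shrunk with the active set by \<open>rate ^ t\<close>. The
  choice of \<open>t\<close> is left open for balancing the two terms.\<close>

lemma mean_rounds_le:
  assumes "conditionally_gibbs I \<mu>"
  shows "mean_rounds I \<mu> \<le> ennreal (real t + cost_factor * (rate ^ t * active_mean \<mu>))"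
proof -
  note cg = conditionally_gibbs_chain[OF assms, of t]
  have "mean_rounds I (chain \<mu> t) \<le>
      (\<integral>\<^sup>+ (\<sigma>, r, n). of_nat (r + n) \<partial>measure_spmf (bind_pmf (chain \<mu> t) (chain_run I)))"
    unfolding mean_rounds_def by (rule nn_integral_mono) auto
  also have "\<dots> \<le> ennreal (cost_factor * active_mean (chain \<mu> t))"
    by (rule mean_total_le[OF cg])
  also have "\<dots> \<le> ennreal (cost_factor * (rate ^ t * active_mean \<mu>))"
    by (intro ennreal_leI mult_left_mono active_mean_chain assms cost_factor_nonneg)
  finally have "of_nat t + mean_rounds I (chain \<mu> t) \<le> of_nat t + ennreal (cost_factor * (rate ^ t * active_mean \<mu>))"
    by (rule add_left_mono)
  also have "\<dots> = ennreal (real t + cost_factor * (rate ^ t * active_mean \<mu>))"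
    using active_mean_nonneg[of \<mu>] cost_factor_nonneg rate_bounds
    by (simp add: ennreal_of_nat_eq_real_of_nat ennreal_plus)
  finally show ?thesis
    using mean_rounds_le_chain[OF assms, of t] by (rule order_trans[rotated])
qed

section \<open>Exactness of the output\<close>

definition chain_output :: "((nat \<Rightarrow> int) \<times> nat set) pmf \<Rightarrow> (nat \<Rightarrow> int) spmf" where
  "chain_output \<mu> = map_spmf fst (bind_pmf \<mu> (chain_run I))"

lemma chain_output_bind: "chain_output \<mu> = bind_pmf \<mu> (\<lambda>x. map_spmf fst (chain_run I x))"
  by (simp add: chain_output_def map_bind_pmf)

text \<open>Once the counters are forgotten, a further step does not change the output law; this
  includes \<open>S = {}\<close>, where the step does nothing.\<close>

lemma chain_output_step:
  assumes S: "S \<subseteq> verts I"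
  shows "map_spmf fst (chain_run I (\<sigma>, S)) = bind_pmf (step I (\<sigma>, S)) (\<lambda>x. map_spmf fst (chain_run I x))"
proof (cases "S = {}")
  case True
  thus ?thesis by (simp add: step_empty bind_return_pmf)
next
  case False
  thus ?thesis
    by (simp add: chain_run_unfold[OF model S] map_bind_pmf pmf.map_comp o_def option.map_comp case_prod_unfold)
qed

lemma chain_output_bind_step:
  assumes "conditionally_gibbs I \<mu>"
  shows "chain_output (bind_pmf \<mu> (step I)) = chain_output \<mu>"
proof -
  have "chain_output \<mu> = bind_pmf \<mu> (\<lambda>x. bind_pmf (step I x) (\<lambda>x. map_spmf fst (chain_run I x)))"
    unfolding chain_output_bind
  proof (rule bind_pmf_cong[OF refl])
    fix x assume "x \<in> set_pmf \<mu>"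
    hence "snd x \<subseteq> verts I" by (rule conditionally_gibbs_active[OF assms])
    from chain_output_step[OF this, of "fst x"]
    show "map_spmf fst (chain_run I x) = bind_pmf (step I x) (\<lambda>x. map_spmf fst (chain_run I x))"
      by simp
  qed
  thus ?thesis by (simp add: chain_output_bind bind_assoc_pmf)
qed

lemma chain_output_chain: "conditionally_gibbs I \<mu> \<Longrightarrow> chain_output (chain \<mu> t) = chain_output \<mu>"
  by (induction t) (auto simp: chain_output_bind_step conditionally_gibbs_chain)

text \<open>A run with empty active set returns its spins at once. From a nonempty \<open>S\<close>
  the two integrands differ by at most 1, hence by at most \<open>card S\<close>.\<close>

lemma chain_output_approx:
  assumes "conditionally_gibbs I \<mu>"
  shows "\<bar>spmf (chain_output \<mu>) \<sigma> - pmf \<mu> (\<sigma>, {})\<bar> \<le> active_mean \<mu>"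
proof -
  let ?o = "\<lambda>x. spmf (map_spmf fst (chain_run I x)) \<sigma>"
  have fin: "finite (set_pmf \<mu>)"
    using assms finite_states[OF model] by (auto simp: conditionally_gibbs_def intro: finite_subset)
  note int = integrable_measure_pmf_finite[OF fin]
  have "spmf (chain_output \<mu>) \<sigma> = measure_pmf.expectation \<mu> ?o"
    by (simp add: chain_output_bind pmf_bind)
  moreover have "pmf \<mu> (\<sigma>, {}) = measure_pmf.expectation \<mu> (indicator {(\<sigma>, {})})"
    by (simp add: measure_pmf_single)
  ultimately have "\<bar>spmf (chain_output \<mu>) \<sigma> - pmf \<mu> (\<sigma>, {})\<bar> =
      \<bar>measure_pmf.expectation \<mu> (\<lambda>x. ?o x - indicator {(\<sigma>, {})} x)\<bar>"
    by (simp only: Bochner_Integration.integral_diff[OF int int])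
  also have "\<dots> \<le> measure_pmf.expectation \<mu> (\<lambda>x. \<bar>?o x - indicator {(\<sigma>, {})} x\<bar>)"
    by (rule integral_abs_bound)
  also have "\<dots> \<le> active_mean \<mu>"
    unfolding active_mean_def
  proof (rule integral_mono_AE[OF int int], rule AE_pmfI)
    fix x assume "x \<in> set_pmf \<mu>"
    hence S: "snd x \<subseteq> verts I" by (rule conditionally_gibbs_active[OF assms])
    obtain \<tau> S where x: "x = (\<tau>, S)" by force
    show "\<bar>?o x - indicator {(\<sigma>, {})} x\<bar> \<le> real (card (snd x))"
    proof (cases "S = {}")
      case True
      thus ?thesis
        using chain_run_unfold[OF model, of "{}" \<tau>] x by (auto simp: indicator_def)
    next
      case False
      have "finite S" using S x model finite_subset by (auto simp: ising_model_def)
      hence "1 \<le> card S" using False by (simp add: Suc_le_eq card_gt_0_iff)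
      thus ?thesis using False x pmf_le_1[of "map_spmf fst (chain_run I x)" "Some \<sigma>"] by simp
    qed
  qed
  finally show ?thesis .
qed

text \<open>The output law is invariant along the chain, so it is the limit of the masses at the
  empty active set. Flip balance passes to the limit and forces proportionality to the weight; total
  mass 1 follows because the active set dies out.\<close>

lemma chain_output_gibbs:
  assumes cg: "conditionally_gibbs I \<mu>"
  shows "chain_output \<mu> = spmf_of_pmf (gibbs I)"
proof -
  let ?o = "spmf (chain_output \<mu>)"
  have zero: "(\<lambda>t. rate ^ t * active_mean \<mu>) \<longlonglongrightarrow> 0"
    using rate_bounds by (intro tendsto_mult_left_zero LIMSEQ_power_zero) (simp only: real_norm_def abs_of_nonneg)
  have lim: "(\<lambda>t. pmf (chain \<mu> t) (\<sigma>, {})) \<longlonglongrightarrow> ?o \<sigma>" for \<sigma>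
  proof (rule LIM_zero_cancel, rule Lim_null_comparison[OF always_eventually zero], rule allI)
    fix t
    have "\<bar>?o \<sigma> - pmf (chain \<mu> t) (\<sigma>, {})\<bar> \<le> rate ^ t * active_mean \<mu>"
      using chain_output_approx[OF conditionally_gibbs_chain[OF cg], of t \<sigma>] active_mean_chain[OF cg, of t]
        chain_output_chain[OF cg, of t] by simp
    thus "norm (pmf (chain \<mu> t) (\<sigma>, {}) - ?o \<sigma>) \<le> rate ^ t * active_mean \<mu>"
      by (simp add: abs_minus_commute)
  qed
  have bal: "?o (flip v \<sigma>) * weight I \<sigma> = ?o \<sigma> * weight I (flip v \<sigma>)"
    if "v \<in> verts I" "\<sigma> \<in> configs I" for v \<sigma>
  proof (rule LIMSEQ_unique)
    show "(\<lambda>t. pmf (chain \<mu> t) (flip v \<sigma>, {}) * weight I \<sigma>) \<longlonglongrightarrow> ?o (flip v \<sigma>) * weight I \<sigma>"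
      by (intro tendsto_mult_right lim)
    have "pmf (chain \<mu> t) (flip v \<sigma>, {}) * weight I \<sigma> = pmf (chain \<mu> t) (\<sigma>, {}) * weight I (flip v \<sigma>)" for t
      using conditionally_gibbs_chain[OF cg, of t] that by (simp add: conditionally_gibbs_def)
    thus "(\<lambda>t. pmf (chain \<mu> t) (flip v \<sigma>, {}) * weight I \<sigma>) \<longlonglongrightarrow> ?o \<sigma> * weight I (flip v \<sigma>)"
      by (simp add: tendsto_mult_right lim)
  qed
  define c where "c = ?o (\<lambda>v\<in>verts I. 1) / weight I (\<lambda>v\<in>verts I. 1)"
  have proportional: "?o \<sigma> = c * weight I \<sigma>" if "\<sigma> \<in> configs I" for \<sigma>
  proof -
    have "?o \<sigma> / weight I \<sigma> = c"
      unfolding c_def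
      by (rule flip_invariant_constant[OF model _ that])
        (use bal weight_pos[of I] in \<open>simp add: frac_eq_eq less_imp_neq[symmetric]\<close>)
    thus ?thesis using weight_pos[of I \<sigma>] by (simp add: field_simps)
  qed
  have out: "?o \<sigma> = 0" if "\<sigma> \<notin> configs I" for \<sigma>
  proof -
    have "pmf (chain \<mu> t) (\<sigma>, {}) = 0" for t
      using conditionally_gibbs_chain[OF cg, of t] that
      by (auto simp: conditionally_gibbs_def set_pmf_iff subset_iff)
    thus ?thesis using LIMSEQ_unique[OF lim[of \<sigma>]] by simp
  qed
  \<comment> \<open>This contains termination with probability 1, which balance alone does not
    give.\<close>
  have "(\<Sum>\<sigma>\<in>configs I. ?o \<sigma>) = 1"
  proof (rule LIMSEQ_unique)
    let ?s = "\<lambda>t. \<Sum>\<sigma>\<in>configs I. pmf (chain \<mu> t) (\<sigma>, {})"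
    show "?s \<longlonglongrightarrow> (\<Sum>\<sigma>\<in>configs I. ?o \<sigma>)"
      by (intro tendsto_sum lim)
    show "?s \<longlonglongrightarrow> 1"
    proof (rule LIM_zero_cancel, rule Lim_null_comparison[OF always_eventually zero], rule allI)
      fix t
      let ?\<nu> = "chain \<mu> t"
      note cg' = conditionally_gibbs_chain[OF cg, of t]
      let ?m = "\<lambda>S. \<Sum>\<sigma>\<in>configs I. pmf ?\<nu> (\<sigma>, S)"
      have fin: "finite (Pow (verts I))" using model by (simp add: ising_model_def)
      have m: "?m S \<ge> 0" for S by (rule sum_nonneg) simp
      have "1 = (\<Sum>x\<in>configs I \<times> Pow (verts I). pmf ?\<nu> x)"
        using sum_pmf_eq_1[OF finite_states[OF model]] cg' by (simp add: conditionally_gibbs_def)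
      also have "\<dots> = (\<Sum>S\<in>Pow (verts I). ?m S)"
        by (subst sum.swap) (simp add: sum.cartesian_product)
      also have "\<dots> = ?m {} + (\<Sum>S\<in>Pow (verts I) - {{}}. ?m S)"
        by (rule sum.remove[OF fin]) simp
      finally have 1: "1 - ?s t = (\<Sum>S\<in>Pow (verts I) - {{}}. ?m S)" by simp
      \<comment> \<open>Markov's inequality: a nonempty set has at least one element.\<close>
      also have "\<dots> \<le> (\<Sum>S\<in>Pow (verts I) - {{}}. real (card S) * ?m S)"
      proof (rule sum_mono)
        fix S assume "S \<in> Pow (verts I) - {{}}"
        hence "1 \<le> card S"
          using model finite_subset by (auto simp: Suc_le_eq card_gt_0_iff ising_model_def)
        thus "?m S \<le> real (card S) * ?m S" using m[of S] mult_right_mono[of 1 "real (card S)" "?m S"] by simp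
      qed
      also have "\<dots> \<le> (\<Sum>S\<in>Pow (verts I). real (card S) * ?m S)"
        by (rule sum_mono2[OF fin]) (auto intro!: mult_nonneg_nonneg m)
      also have "\<dots> = active_mean ?\<nu>"
        by (rule active_mean_sum[OF cg', symmetric])
      also have "\<dots> \<le> rate ^ t * active_mean \<mu>"
        by (rule active_mean_chain[OF cg])
      finally have "1 - ?s t \<le> rate ^ t * active_mean \<mu>" .
      moreover have "0 \<le> 1 - ?s t"
        unfolding 1 by (rule sum_nonneg) (rule m)
      ultimately show "norm (?s t - 1) \<le> rate ^ t * active_mean \<mu>" by simp
    qed
  qed
  hence "c * partition_function I = 1"
    unfolding partition_function_def sum_distrib_left by (simp add: proportional)
  hence "c = 1 / partition_function I"
    using partition_function_pos[OF model] by (simp add: field_simps)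
  thus ?thesis
    by (intro spmf_eqI) (simp add: pmf_gibbs[OF model] proportional out)
qed

end

section \<open>The law after the update\<close>

definition transfer :: "ising \<Rightarrow> ising \<Rightarrow> (nat \<Rightarrow> int) \<Rightarrow> nat \<Rightarrow> int" where
  "transfer I I' X = (\<lambda>v\<in>verts I'. if v \<in> verts I then X v else 1)"

text \<open>Comparing views detects a change of the set of incident edges as well as of an inverse
  temperature on one of them. The set does not involve the given sample, so starting from it does
  not bias the inactive spins.\<close>

definition dirty :: "ising \<Rightarrow> ising \<Rightarrow> nat set" where
  "dirty I I' = {v \<in> verts I'. v \<notin> verts I \<or>
     view (incident I v) (beta I) \<noteq> view (incident I' v) (beta I')}"

definition initial_law :: "ising \<Rightarrow> ising \<Rightarrow> ((nat \<Rightarrow> int) \<times> nat set) pmf" where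
  "initial_law I I' = map_pmf (\<lambda>X. (transfer I I' X, dirty I I')) (gibbs I)"

lemma dynamic_sample_resampler:
  assumes "ising_model I'"
  shows "dynamic_sample resampler I I' = bind_pmf (initial_law I I') (chain_run I')"
proof -
  have "active I' (snd (initial_state resampler I I' X)) = dirty I I'" for X
    by (auto simp: active_def initial_state_def resampler_def dirty_def view_def nbhd_def)
  moreover have "fst (initial_state resampler I I' X) = transfer I I' X" for X
    by (simp add: initial_state_def transfer_def)
  ultimately have "run resampler I' (initial_state resampler I I' X) = chain_run I' (transfer I I' X, dirty I I')" for X
    by (metis run_resampler_eq_chain_run[OF assms] prod.collapse)
  thus ?thesis
    by (simp add: dynamic_sample_def initial_law_def bind_map_pmf)
qed

lemma view_eqD:
  assumes "view A f = view B g"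
  shows "A = B" "\<And>x. x \<in> A \<Longrightarrow> f x = g x"
proof -
  have *: "(if x \<in> A then Some (f x) else None) = (if x \<in> B then Some (g x) else None)" for x
    using fun_cong[OF assms, of x] by (simp add: view_def)
  show "A = B" using * by (metis option.distinct(1) subsetI subset_antisym)
  thus "f x = g x" if "x \<in> A" for x using that *[of x] by simp
qed

section \<open>Size of the initial active set\<close>

lemma finite_updated_edges:
  "ising_model I \<Longrightarrow> ising_model I' \<Longrightarrow> finite (updated_edges I I')"
  by (simp add: updated_edges_def finite_edges)

text \<open>A vertex whose view changed lies on an updated edge, and each such edge has two
  endpoints. Neighbours of a deleted vertex are covered, since the edges lost with it count as
  updated.\<close>

lemma card_dirty_le:
  assumes "ising_model I" "ising_model I'"
  shows "card (dirty I I') \<le> 2 * update_size I I'"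
proof -
  have fin: "finite (updated_verts I I')" "finite (updated_edges I I')"
    using assms finite_updated_edges by (auto simp: updated_verts_def ising_model_def)
  have two: "card e = 2" "finite e" if "e \<in> updated_edges I I'" for e
    using that assms by (auto simp: updated_edges_def ising_model_def intro: card_ge_0_finite)
  have "dirty I I' \<subseteq> updated_verts I I' \<union> \<Union>(updated_edges I I')"
  proof
    fix v assume v: "v \<in> dirty I I'"
    show "v \<in> updated_verts I I' \<union> \<Union>(updated_edges I I')"
    proof (rule ccontr)
      assume n: "\<not> ?thesis"
      hence "v \<in> verts I" using v by (auto simp: dirty_def updated_verts_def)
      moreover have "view (incident I v) (beta I) = view (incident I' v) (beta I')"
        using n by (auto simp: view_def incident_def updated_edges_def fun_eq_iff)
      ultimately show False using v by (simp add: dirty_def)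
    qed
  qed
  hence "card (dirty I I') \<le> card (updated_verts I I' \<union> \<Union>(updated_edges I I'))"
    by (rule card_mono[rotated]) (use fin two in auto)
  also have "\<dots> \<le> card (updated_verts I I') + card (\<Union>(updated_edges I I'))"
    by (rule card_Un_le)
  also have "card (\<Union>(updated_edges I I')) \<le> (\<Sum>e\<in>updated_edges I I'. card e)"
    by (rule card_Union_le_sum_card)
  also have "\<dots> = 2 * card (updated_edges I I')"
    by (simp add: two)
  finally show ?thesis by (simp add: update_size_def)
qed

section \<open>Balance of the transferred sample\<close>

definition local_weight :: "ising \<Rightarrow> nat \<Rightarrow> (nat \<Rightarrow> int) \<Rightarrow> real" where
  "local_weight I v \<sigma> = (\<Prod>e\<in>incident I v. exp (beta I e * real_of_int (\<Prod>u\<in>e. \<sigma> u)))"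

lemma local_weight_pos: "local_weight I v \<sigma> > 0"
  by (simp add: local_weight_def prod_pos)

lemma weight_flip_local:
  assumes "ising_model I"
  shows "weight I (flip v \<sigma>) * local_weight I v \<sigma> = weight I \<sigma> * local_weight I v (flip v \<sigma>)"
proof -
  let ?g = "\<lambda>\<sigma> e. exp (beta I e * real_of_int (\<Prod>u\<in>e. \<sigma> u))"
  have split: "weight I \<sigma> = prod (?g \<sigma>) (edges I - incident I v) * local_weight I v \<sigma>" for \<sigma>
    unfolding weight_def local_weight_def
    by (rule prod.subset_diff) (auto simp: incident_def finite_edges[OF assms])
  have "prod (?g (flip v \<sigma>)) (edges I - incident I v) = prod (?g \<sigma>) (edges I - incident I v)"
  proof (rule prod.cong[OF refl])
    fix e assume "e \<in> edges I - incident I v"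
    hence "finite e" "v \<notin> e"
      using assms finite_subset by (auto simp: ising_model_def incident_def)
    thus "?g (flip v \<sigma>) e = ?g \<sigma> e" by (simp add: prod_flip)
  qed
  thus ?thesis by (simp add: split)
qed

text \<open>Both models have the same edges and inverse temperatures at \<open>v\<close>. These
  edges lie in both graphs, so \<open>transfer\<close> keeps the spins of all their
  endpoints.\<close>

lemma local_weight_transfer:
  assumes "ising_model I" "ising_model I'" "v \<in> verts I' - dirty I I'"
  shows "local_weight I' v (transfer I I' X) = local_weight I v X"
proof -
  have "view (incident I v) (beta I) = view (incident I' v) (beta I')"
    using assms(3) by (auto simp: dirty_def)
  note same = view_eqD[OF this]
  show ?thesis
    unfolding local_weight_def same(1)[symmetric]
  proof (rule prod.cong[OF refl])
    fix e assume e: "e \<in> incident I v"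
    hence "e \<in> incident I' v" using same(1) by simp
    with e have "e \<subseteq> verts I" "e \<subseteq> verts I'"
      using assms(1,2) by (auto simp: incident_def ising_model_def)
    hence "(\<Prod>u\<in>e. transfer I I' X u) = (\<Prod>u\<in>e. X u)"
      by (intro prod.cong) (auto simp: transfer_def)
    thus "exp (beta I' e * real_of_int (\<Prod>u\<in>e. transfer I I' X u)) = exp (beta I e * real_of_int (\<Prod>u\<in>e. X u))"
      using same(2)[OF e] by simp
  qed
qed

lemma transfer_flip:
  "v \<in> verts I \<Longrightarrow> v \<in> verts I' \<Longrightarrow> transfer I I' (flip v X) = flip v (transfer I I' X)"
  by (auto simp: transfer_def flip_def fun_eq_iff)

text \<open>By \<open>weight_flip_local\<close> the effect of the flip on a weight is a ratio of
  local weights at \<open>v\<close>, and these agree in the two models.\<close>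

lemma weight_transfer_flip:
  assumes "ising_model I" "ising_model I'" "v \<in> verts I' - dirty I I'"
  shows "weight I (flip v X) * weight I' (transfer I I' X) =
    weight I X * weight I' (flip v (transfer I I' X))"
proof -
  let ?T = "transfer I I'"
  let ?l = "local_weight I v X" and ?l' = "local_weight I v (flip v X)"
  have v: "v \<in> verts I" "v \<in> verts I'" using assms(3) by (auto simp: dirty_def)
  have 1: "weight I (flip v X) * ?l = weight I X * ?l'"
    by (rule weight_flip_local[OF assms(1)])
  have 2: "weight I' (flip v (?T X)) * ?l = weight I' (?T X) * ?l'"
    using weight_flip_local[OF assms(2), of v "?T X"] local_weight_transfer[OF assms]
      transfer_flip[OF v, of X] by metis
  have "weight I (flip v X) * weight I' (?T X) * ?l = weight I' (?T X) * (weight I (flip v X) * ?l)"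
    by simp
  also have "\<dots> = weight I X * (weight I' (?T X) * ?l')" unfolding 1 by simp
  also have "\<dots> = weight I X * weight I' (flip v (?T X)) * ?l" unfolding 2[symmetric] by simp
  finally show ?thesis using local_weight_pos[of I v X] by simp
qed

lemma set_gibbs: "ising_model I \<Longrightarrow> set_pmf (gibbs I) \<subseteq> configs I"
  by (auto simp: set_pmf_iff pmf_gibbs split: if_splits)

text \<open>The active set is the constant \<open>dirty I I'\<close>, and a flip outside it changes
  the old and the new weight by the same ratio.\<close>

lemma conditionally_gibbs_initial_law:
  assumes I: "ising_model I" and I': "ising_model I'"
  shows "conditionally_gibbs I' (initial_law I I')"
  unfolding conditionally_gibbs_def
proof (intro conjI allI ballI impI)
  have "transfer I I' X \<in> configs I'" if "X \<in> configs I" for X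
    using that by (auto simp: transfer_def configs_def PiE_def Pi_def)
  thus "set_pmf (initial_law I I') \<subseteq> configs I' \<times> Pow (verts I')"
    using set_gibbs[OF I] by (auto simp: initial_law_def dirty_def)
next
  fix S v \<sigma> assume \<sigma>: "\<sigma> \<in> configs I'" and v: "v \<in> verts I' - S"
  show "pmf (initial_law I I') (flip v \<sigma>, S) * weight I' \<sigma> =
    pmf (initial_law I I') (\<sigma>, S) * weight I' (flip v \<sigma>)"
  proof (cases "S = dirty I I'")
    case False
    hence "pmf (initial_law I I') (\<tau>, S) = 0" for \<tau>
      by (auto simp: initial_law_def pmf_eq_0_set_pmf)
    thus ?thesis by simp
  next
    case True
    have vI: "v \<in> verts I" "v \<in> verts I'" using v True by (auto simp: dirty_def)
    \<comment> \<open>\<open>transfer\<close> forgets the spins of deleted vertices, so a point mass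
      is a sum over a fibre. The flip at \<open>v\<close> carries the fibre of
      \<open>\<sigma>\<close> onto that of \<open>flip v \<sigma>\<close>.\<close>
    let ?F = "\<lambda>\<tau>. {X \<in> configs I. transfer I I' X = \<tau>}" and ?Z = "partition_function I"
    have pmf: "pmf (initial_law I I') (\<tau>, S) = (\<Sum>X\<in>?F \<tau>. weight I X / ?Z)" for \<tau>
    proof -
      have "pmf (initial_law I I') (\<tau>, S) =
          measure (gibbs I) ({X. transfer I I' X = \<tau>} \<inter> set_pmf (gibbs I))"
        using True by (simp add: initial_law_def pmf_map vimage_def measure_Int_set_pmf)
      also have "{X. transfer I I' X = \<tau>} \<inter> set_pmf (gibbs I) = ?F \<tau> \<inter> set_pmf (gibbs I)"
        using set_gibbs[OF I] by auto
      also have "measure (gibbs I) \<dots> = (\<Sum>X\<in>?F \<tau>. pmf (gibbs I) X)"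
        unfolding measure_Int_set_pmf
        by (rule measure_measure_pmf_finite) (simp add: finite_configs[OF I])
      also have "\<dots> = (\<Sum>X\<in>?F \<tau>. weight I X / ?Z)"
        by (rule sum.cong) (auto simp: pmf_gibbs[OF I])
      finally show ?thesis .
    qed
    have "(\<Sum>X\<in>?F \<sigma>. weight I X / ?Z * weight I' (flip v \<sigma>)) =
        (\<Sum>X\<in>?F (flip v \<sigma>). weight I X / ?Z * weight I' \<sigma>)"
    proof (rule sum.reindex_bij_witness[of _ "flip v" "flip v"])
      fix X assume X: "X \<in> ?F \<sigma>"
      have "weight I (flip v X) * weight I' (transfer I I' X) =
          weight I X * weight I' (flip v (transfer I I' X))"
        using v True by (intro weight_transfer_flip[OF I I']) simp
      thus "weight I (flip v X) / ?Z * weight I' \<sigma> = weight I X / ?Z * weight I' (flip v \<sigma>)"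
        using X by simp
    qed (use vI in \<open>auto simp: transfer_flip\<close>)
    thus ?thesis by (simp add: pmf sum_distrib_right)
  qed
qed

section \<open>Explicit constants and conclusion\<close>

lemma active_mean_initial_law: "active_mean (initial_law I I') = real (card (dirty I I'))"
  by (simp add: active_mean_def initial_law_def)

text \<open>Since \<open>1 - 1 / B \<le> exp (- 1 / B)\<close>, about \<open>B * ln (2 * k)\<close>
  steps bring the decaying term below \<open>K\<close>. The remaining constants are absorbed by
  \<open>ln (k + 1)\<close>, which is at least \<open>ln 2\<close>, whereas \<open>ln k\<close>
  vanishes at \<open>k = 1\<close>.\<close>

lemma logarithmic_round_bound:
  fixes B K :: real and k :: nat
  assumes "B \<ge> 1" "K \<ge> 0" "k \<ge> 1"
  shows "\<exists>t. real t + K * ((1 - 1 / B) ^ t * (2 * real k)) \<le>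
    (2 * B + (1 + K) / ln 2) * ln (real k + 1)"
proof -
  define t where "t = nat \<lceil>B * ln (2 * real k)\<rceil>"
  have k: "real k \<ge> 1" using assms(3) by simp
  have l0: "0 \<le> ln (2 * real k)" using k by simp
  hence t: "B * ln (2 * real k) \<le> real t" "real t \<le> B * ln (2 * real k) + 1"
    using assms(1) by (auto simp: t_def)
  have "(1 - 1 / B) ^ t \<le> exp (- 1 / B) ^ t"
    using assms(1) exp_ge_add_one_self[of "- 1 / B"] by (intro power_mono) auto
  also have "\<dots> = exp (- (real t / B))"
    by (simp add: exp_of_nat_mult[symmetric])
  also have "\<dots> \<le> exp (- ln (2 * real k))"
    using t(1) assms(1) by (simp add: pos_le_divide_eq mult.commute)
  also have "\<dots> = 1 / (2 * real k)"
    using k by (simp add: exp_minus inverse_eq_divide)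
  finally have "(1 - 1 / B) ^ t * (2 * real k) \<le> 1"
    using k by (simp add: field_simps)
  hence "K * ((1 - 1 / B) ^ t * (2 * real k)) \<le> K * 1"
    by (rule mult_left_mono[OF _ assms(2)])
  moreover have "ln (2 * real k) \<le> 2 * ln (real k + 1)"
  proof -
    have "2 * real k \<le> (real k + 1)\<^sup>2" by (simp add: power2_eq_square algebra_simps)
    hence "ln (2 * real k) \<le> ln ((real k + 1)\<^sup>2)" using k by (subst ln_le_cancel_iff) auto
    also have "\<dots> = 2 * ln (real k + 1)" using k by (simp add: ln_realpow)
    finally show ?thesis .
  qed
  hence "B * ln (2 * real k) \<le> B * (2 * ln (real k + 1))"
    by (rule mult_left_mono) (use assms in simp)
  moreover have "1 + K \<le> (1 + K) / ln 2 * ln (real k + 1)"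
  proof -
    have "ln 2 \<le> ln (real k + 1)" using k by simp
    hence "(1 + K) * ln 2 \<le> (1 + K) * ln (real k + 1)" by (rule mult_left_mono) (use assms in simp)
    thus ?thesis by (simp add: pos_le_divide_eq)
  qed
  ultimately have "real t + K * ((1 - 1 / B) ^ t * (2 * real k)) \<le> (2 * B + (1 + K) / ln 2) * ln (real k + 1)"
    using t(2) by (simp add: distrib_right)
  thus ?thesis ..
qed

text \<open>The sampler is fixed before the degree bound, and only the constant depends on
  \<open>D\<close>. The factor \<open>ln (k + 1)\<close> vanishes for an empty update but not for
  \<open>k = 1\<close>.\<close>

theorem theorem3:
  fixes \<alpha> :: real
  assumes "\<alpha> = 1 + 2 / (1 + exp (- 1 / \<alpha>))"
  shows "\<exists>A :: sampler. \<forall>D :: nat. \<exists>C :: real. \<forall>I I' :: ising.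
           ising_model I \<longrightarrow> ising_model I' \<longrightarrow> max_degree I' \<le> D \<longrightarrow>
           (\<forall>e\<in>edges I'. exp (- 2 * \<bar>beta I' e\<bar>) \<ge> 1 - 1 / (\<alpha> * real (max_degree I') + 1)) \<longrightarrow>
             output_law A I I' = spmf_of_pmf (gibbs I') \<and>
             expected_rounds A I I' \<le> ennreal (C * ln (real (update_size I I') + 1)) \<and>
             expected_cost A I I' \<le> ennreal (C * real (update_size I I'))"
proof (rule exI[of _ resampler], rule allI)
  fix D :: nat
  \<comment> \<open>\<open>B\<close> bounds \<open>1 / (1 - rate)\<close> and \<open>K\<close>
    bounds \<open>cost_factor\<close>, uniformly over degrees up to \<open>D\<close>.
    \<open>C\<close> adds the constant of \<open>logarithmic_round_bound\<close> and the cost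
    constant \<open>2 * K\<close>, whose factor 2 comes from \<open>card_dirty_le\<close>.\<close>
  define B where "B = \<alpha> * real D + 1"
  define K where "K = (real D + 2) * B"
  define C where "C = 2 * B + (1 + K) / ln 2 + 2 * K"
  show "\<exists>C. \<forall>I I'. ising_model I \<longrightarrow> ising_model I' \<longrightarrow> max_degree I' \<le> D \<longrightarrow>
      (\<forall>e\<in>edges I'. exp (- 2 * \<bar>beta I' e\<bar>) \<ge> 1 - 1 / (\<alpha> * real (max_degree I') + 1)) \<longrightarrow>
        output_law resampler I I' = spmf_of_pmf (gibbs I') \<and>
        expected_rounds resampler I I' \<le> ennreal (C * ln (real (update_size I I') + 1)) \<and>
        expected_cost resampler I I' \<le> ennreal (C * real (update_size I I'))"
  proof (rule exI[of _ C], intro allI impI)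
    fix I I' assume I: "ising_model I" and I': "ising_model I'" and D: "max_degree I' \<le> D"
      and coupling: "\<forall>e\<in>edges I'. exp (- 2 * \<bar>beta I' e\<bar>) \<ge> 1 - 1 / (\<alpha> * real (max_degree I') + 1)"
    interpret subcritical_ising I' \<alpha>
      using I' assms coupling by unfold_locales auto
    let ?\<mu> = "initial_law I I'" and ?k = "update_size I I'"
    note cg = conditionally_gibbs_initial_law[OF I I']
    have B: "B \<ge> 1" using alpha_gt_1 by (simp add: B_def)
    have K: "K \<ge> 0" using B by (simp add: K_def)
    have C: "2 * B + (1 + K) / ln 2 \<le> C" "2 * K \<le> C"
      using B K by (auto simp: C_def intro!: divide_nonneg_pos add_nonneg_nonneg)
    have size: "active_mean ?\<mu> \<le> 2 * real ?k"
      using card_dirty_le[OF I I'] by (simp add: active_mean_initial_law flip: of_nat_le_iff)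
    have deg: "\<alpha> * \<Delta> + 1 \<le> B"
      using D alpha_gt_1 by (simp add: B_def)
    have pos: "\<alpha> * \<Delta> + 1 > 0" using alpha_gt_1 by (simp add: add_nonneg_pos)
    \<comment> \<open>In this form the rate is visibly increasing in the degree, so \<open>D\<close>
      may replace the actual maximum degree.\<close>
    have "rate = 1 - 1 / (\<alpha> * \<Delta> + 1)" using pos by (simp add: field_simps)
    also have "\<dots> \<le> 1 - 1 / B" using deg pos by (simp add: frac_le)
    finally have rate: "rate \<le> 1 - 1 / B" .
    have cost: "cost_factor \<le> K"
      unfolding K_def using D deg pos by (intro mult_mono) auto
    have sample: "dynamic_sample resampler I I' = bind_pmf ?\<mu> (chain_run I')"
      by (rule dynamic_sample_resampler[OF I'])
    have "output_law resampler I I' = spmf_of_pmf (gibbs I')"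
      using chain_output_gibbs[OF cg] by (simp add: output_law_def sample chain_output_def)
    moreover have "expected_rounds resampler I I' \<le> ennreal (C * ln (real ?k + 1))"
    proof -
      have "\<exists>t. real t + K * ((1 - 1 / B) ^ t * (2 * real ?k)) \<le> C * ln (real ?k + 1)"
      proof (cases "?k = 0")
        case True
        thus ?thesis by (intro exI[of _ 0]) simp
      next
        case False
        then obtain t where "real t + K * ((1 - 1 / B) ^ t * (2 * real ?k)) \<le>
            (2 * B + (1 + K) / ln 2) * ln (real ?k + 1)"
          using logarithmic_round_bound[OF B K, of ?k] by auto
        also have "\<dots> \<le> C * ln (real ?k + 1)"
          using C(1) by (rule mult_right_mono) simp
        finally show ?thesis ..
      qed
      then obtain t where t: "real t + K * ((1 - 1 / B) ^ t * (2 * real ?k)) \<le> C * ln (real ?k + 1)" ..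
      have "expected_rounds resampler I I' = mean_rounds I' ?\<mu>"
        by (simp add: expected_rounds_def mean_rounds_def sample)
      also have "\<dots> \<le> ennreal (real t + cost_factor * (rate ^ t * active_mean ?\<mu>))"
        by (rule mean_rounds_le[OF cg])
      also have "\<dots> \<le> ennreal (real t + K * ((1 - 1 / B) ^ t * (2 * real ?k)))"
        using cost rate size K rate_bounds(1) active_mean_nonneg
        by (intro ennreal_leI add_left_mono mult_mono power_mono mult_nonneg_nonneg zero_le_power) auto
      also have "\<dots> \<le> ennreal (C * ln (real ?k + 1))"
        by (rule ennreal_leI[OF t])
      finally show ?thesis .
    qed
    moreover have "expected_cost resampler I I' \<le> ennreal (C * real ?k)"
    proof -
      have "expected_cost resampler I I' \<le>
          (\<integral>\<^sup>+ (\<sigma>, r, n). of_nat (r + n) \<partial>measure_spmf (bind_pmf ?\<mu> (chain_run I')))"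
        unfolding expected_cost_def sample by (rule nn_integral_mono) auto
      also have "\<dots> \<le> ennreal (cost_factor * active_mean ?\<mu>)"
        by (rule mean_total_le[OF cg])
      also have "\<dots> \<le> ennreal (K * (2 * real ?k))"
        using cost size K active_mean_nonneg by (intro ennreal_leI mult_mono) auto
      also have "\<dots> \<le> ennreal (C * real ?k)"
        using mult_right_mono[OF C(2), of "real ?k"] by (intro ennreal_leI) simp
      finally show ?thesis .
    qed
    ultimately show "output_law resampler I I' = spmf_of_pmf (gibbs I') \<and>
        expected_rounds resampler I I' \<le> ennreal (C * ln (real ?k + 1)) \<and>
        expected_cost resampler I I' \<le> ennreal (C * real ?k)"
      by blast
  qed
qed

end
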